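(* Let $\nu>0$ and let $\mathcal{M}(\cdot;\nu)$ be the Matérn function $$\mathcal{M}(t;\nu)=\frac{2^{1-\nu}}{\Gamma(\nu)}\,t^{\nu}\mathcal{K}_\nu(t),\qquad t\ge0,$$ with $\mathcal{M}(0;\nu)=1$. Let $0<\beta_1<\beta_2$ and, for $\varepsilon\in\mathbb{R}$, $\varepsilon\ne0$, let $$K_{\varepsilon;\nu;\beta_2,\beta_1}[\mathcal{M}](t)=\frac{\beta_2^{\varepsilon}\mathcal{M}(t/\beta_2;\nu)-\beta_1^{\varepsilon}\mathcal{M}(t/\beta_1;\nu)}{\beta_2^{\varepsilon}-\beta_1^{\varepsilon}},\qquad t\ge0.$$ 1. Let $\varepsilon>0$. Then $K_{\varepsilon;\nu;\beta_2,\beta_1}[\mathcal{M}]\in\Phi_\infty$ if and only if $\varepsilon\ge2\nu>0$. 2. For a given $d\in\mathbb{N}$ (a positive integer), let $\varepsilon<0$. Then $K_{\varepsilon;\nu;\beta_2,\beta_1}[\mathcal{M}]\in\Phi_d$ if and only if $\varepsilon\le-d<0$.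
   Context: For a positive integer $d$, $\Phi_d$ is the class of continuous functions $\phi:[0,\infty)\to\mathbb{R}$ with $\phi(0)=1$ such that $\boldsymbol x\mapsto\phi(\|\boldsymbol x\|)$ is positive definite on $\mathbb{R}^d$; here $f:\mathbb{R}^d\to\mathbb{R}$ is positive definite if $\sum_{k=1}^N\sum_{h=1}^N a_k f(\boldsymbol x_k-\boldsymbol x_h)a_h\ge0$ for every finite collection $a_1,\dots,a_N\in\mathbb{R}$ and points $\boldsymbol x_1,\dots,\boldsymbol x_N\in\mathbb{R}^d$. $\Phi_\infty=\bigcap_{d\ge1}\Phi_d$. $\mathcal{K}_\nu$ is the modified Bessel function of the second kind of order $\nu$. *)

theory Defs
  imports "HOL-Analysis.Analysis"
begin

text \<open>
  \<open>\<real>\<^sup>d\<close> for a dimension that is quantified inside formulas: real sequences whose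
  coordinates vanish from index \<open>d\<close> on, with the pointwise difference from the function
  instance of class \<open>minus\<close>. The Euclidean norm of \<open>x\<close> is \<open>L2_set x {..<d}\<close>.
\<close>

definition Rd :: "nat \<Rightarrow> (nat \<Rightarrow> real) set" where
  "Rd d = {x. \<forall>i\<ge>d. x i = 0}"

definition positive_definite :: "nat \<Rightarrow> ((nat \<Rightarrow> real) \<Rightarrow> real) \<Rightarrow> bool" where
  "positive_definite d f \<longleftrightarrow>
     (\<forall>(N::nat) (a :: nat \<Rightarrow> real) (x :: nat \<Rightarrow> nat \<Rightarrow> real).
        (\<forall>k<N. x k \<in> Rd d) \<longrightarrow>
        (\<Sum>k<N. \<Sum>h<N. a k * f (x k - x h) * a h) \<ge> 0)"

text \<open>
  Functions on \<open>[0,\<infinity>)\<close> are rendered as functions on all reals; no condition below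
  depends on the values at negative arguments.
\<close>

definition Phi :: "nat \<Rightarrow> (real \<Rightarrow> real) set" where
  "Phi d = {\<phi>. continuous_on {0..} \<phi> \<and> \<phi> 0 = 1 \<and>
                positive_definite d (\<lambda>x. \<phi> (L2_set x {..<d}))}"

definition Phi_inf :: "(real \<Rightarrow> real) set" where
  "Phi_inf = (\<Inter>d\<in>{1..}. Phi d)"

text \<open>
  The modified Bessel function of the second kind for real order and argument \<open>t > 0\<close>,
  defined by its classical integral representation (the integral converges absolutely
  for every real \<open>\<nu>\<close> and every \<open>t > 0\<close>; the value at \<open>t \<le> 0\<close> is meaningless).
\<close>

definition bessel_K :: "real \<Rightarrow> real \<Rightarrow> real" where
  "bessel_K \<nu> t = (LINT u:{0..}|lborel. exp (- t * cosh u) * cosh (\<nu> * u))"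

definition matern :: "real \<Rightarrow> real \<Rightarrow> real" where
  "matern t \<nu> =
     (if t = 0 then 1 else 2 powr (1 - \<nu>) / Gamma \<nu> * t powr \<nu> * bessel_K \<nu> t)"

text \<open>The operator acts on a parametric family \<open>\<phi>(t; \<nu>)\<close>, here \<open>\<phi> t \<nu>\<close>.\<close>

definition K_op :: "real \<Rightarrow> real \<Rightarrow> real \<Rightarrow> real \<Rightarrow> (real \<Rightarrow> real \<Rightarrow> real) \<Rightarrow> real \<Rightarrow> real" where
  "K_op \<epsilon> \<nu> \<beta>2 \<beta>1 \<phi> t =
     (\<beta>2 powr \<epsilon> * \<phi> (t / \<beta>2) \<nu> - \<beta>1 powr \<epsilon> * \<phi> (t / \<beta>1) \<nu>) /
     (\<beta>2 powr \<epsilon> - \<beta>1 powr \<epsilon>)"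

end

theory Submission
  imports Defs "HOL-Probability.Probability"
begin

text \<open>
  Write \<open>M\<^sub>\<beta>(x) = M(\<parallel>x\<parallel> / \<beta>)\<close> for the scaled Matern function on \<open>\<real>\<^sup>d\<close>. Its Fourier transform is
  proportional to \<open>\<beta>\<^sup>d (1 + \<beta>\<^sup>2\<parallel>z\<parallel>\<^sup>2) powr (-\<nu> - d/2)\<close>, so the operator has, up to a positive factor,
  the spectral density \<open>(f(\<beta>2) - f(\<beta>1)) / (\<beta>2 powr \<epsilon> - \<beta>1 powr \<epsilon>)\<close> with
  \<open>f(\<beta>) = \<beta> powr (\<epsilon> + d) (1 + \<beta>\<^sup>2\<parallel>z\<parallel>\<^sup>2) powr (-\<nu> - d/2)\<close>. At \<open>z = 0\<close> the function \<open>f\<close> equals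
  \<open>\<beta> powr (\<epsilon> + d)\<close>; for \<open>\<parallel>z\<parallel> \<rightarrow> \<infinity>\<close> it behaves like a multiple of \<open>\<beta> powr (\<epsilon> - 2\<nu>)\<close>. For \<open>\<epsilon> < 0\<close> the first regime decides,
  for \<open>\<epsilon> > 0\<close> the second. The proof makes this rigorous without Bochner's theorem and without
  Fourier transforms in several variables; the starting point is the representation
  \<open>\<Gamma>(\<nu>) M(t) = \<integral> s powr (\<nu> - 1) exp(-s) exp(-t\<^sup>2 / 4s) ds\<close> as a mixture of Gaussians
  (\<open>matern_gaussian_mixture\<close>).

  Sufficiency. Order even functions by positive definiteness of their difference. Every Gaussian is
  positive, and the heat kernels \<open>u powr (-d/2) exp(-\<parallel>x\<parallel>\<^sup>2 / 4u)\<close> decrease in \<open>u\<close>, because their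
  Fourier transforms \<open>exp(-u\<parallel>z\<parallel>\<^sup>2)\<close> do (\<open>pd_kernel_heat_prod_diff\<close>). Substituted into the mixture,
  these two facts show that \<open>\<beta> powr (-d) M\<^sub>\<beta>\<close> decreases in \<open>\<beta>\<close>
  (\<open>pd_kernel_matern_normalized_antimono\<close>) and that \<open>\<beta> powr (2\<nu>) M\<^sub>\<beta>\<close> increases in \<open>\<beta>\<close>
  (\<open>pd_kernel_matern_weighted_mono\<close>). These are the boundary cases \<open>\<epsilon> = -d\<close> and \<open>\<epsilon> = 2\<nu>\<close>;
  all other cases add a nonnegative multiple of \<open>M\<^sub>\<beta>\<^sub>2\<close>.

  Necessity. If \<open>K\<close> is a bounded positive definite kernel and \<open>X, Y\<close> are independent with the same
  distribution, then the expectation of \<open>K(X, Y)\<close> is nonnegative (\<open>pd_kernel_expectation_nonneg\<close>).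
  For normal \<open>X, Y\<close> with variance \<open>\<sigma>\<^sup>2\<close> in each of the \<open>d\<close> coordinates and the kernel
  \<open>\<phi>(\<parallel>x - y\<parallel>) cos(\<omega>(x\<^sub>0 - y\<^sub>0))\<close> this expectation is explicit on Gaussians, hence on Matern functions.
  Multiplied by \<open>\<sigma>\<^sup>d\<close> it converges for \<open>\<sigma> \<rightarrow> \<infinity>\<close> to a positive multiple of the spectral density at
  frequency \<open>\<omega>\<close>, which is therefore nonnegative (\<open>K_op_matern_spectral_density_nonneg\<close>).
  The frequency \<open>\<omega> = 0\<close> gives \<open>\<epsilon> \<le> -d\<close>, the limit \<open>\<omega> \<rightarrow> \<infinity>\<close> with \<open>d = 1\<close> gives \<open>\<epsilon> \<ge> 2\<nu>\<close>.
\<close>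

section \<open>Positive definite kernels and heat kernels\<close>

text \<open>
  The characteristic function of the standard normal distribution, rescaled.
\<close>

lemma gaussian_fourier:
  fixes u x :: real
  assumes u: "u > 0"
  shows "has_bochner_integral lborel (\<lambda>z. exp (- u * z\<^sup>2) * cos (z * x))
           (sqrt pi * (exp (- x\<^sup>2 / (4 * u)) / sqrt u))"
proof -
  let ?N = std_normal_distribution
  define t where "t = x / sqrt (2 * u)"
  interpret N: prob_space ?N by (rule prob_space_normal_density) simp
  have int: "integrable ?N (\<lambda>y. iexp (t * y))"
    by (rule N.integrable_const_bound[where B = 1]) auto
  have "(\<integral>y. cos (t * y) \<partial>?N) = (\<integral>y. Re (iexp (t * y)) \<partial>?N)"
    by (simp add: Re_exp)
  also have "\<dots> = Re (char ?N t)"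
    unfolding char_def using int by (rule integral_Re)
  also have "\<dots> = exp (- t\<^sup>2 / 2)"
    by (simp add: char_std_normal_distribution)
  finally have val: "(\<integral>y. cos (t * y) \<partial>?N) = exp (- t\<^sup>2 / 2)" .
  have "integrable ?N (\<lambda>y. cos (t * y))"
    by (rule N.integrable_const_bound[where B = 1]) auto
  with val have "has_bochner_integral lborel (\<lambda>y. std_normal_density y * cos (t * y)) (exp (- t\<^sup>2 / 2))"
    by (simp add: has_bochner_integral_iff integral_density integrable_density)
  then have "has_bochner_integral lborel
      (\<lambda>z. std_normal_density (0 + sqrt (2 * u) * z) * cos (t * (0 + sqrt (2 * u) * z)))
      (exp (- t\<^sup>2 / 2) /\<^sub>R \<bar>sqrt (2 * u)\<bar>)"
    using u by (subst (asm) lborel_has_bochner_integral_real_affine_iff[where c = "sqrt (2 * u)" and t = 0]) auto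
  then have "has_bochner_integral lborel
      (\<lambda>z. sqrt (2 * pi) * (std_normal_density (0 + sqrt (2 * u) * z) * cos (t * (0 + sqrt (2 * u) * z))))
      (sqrt (2 * pi) * (exp (- t\<^sup>2 / 2) /\<^sub>R \<bar>sqrt (2 * u)\<bar>))"
    by (rule has_bochner_integral_mult_right)
  moreover have "(\<lambda>z. sqrt (2 * pi) * (std_normal_density (0 + sqrt (2 * u) * z) * cos (t * (0 + sqrt (2 * u) * z))))
      = (\<lambda>z. exp (- u * z\<^sup>2) * cos (z * x))"
    using u by (simp add: fun_eq_iff std_normal_density_def t_def power_mult_distrib mult_ac)
  moreover have "sqrt (2 * pi) * (exp (- t\<^sup>2 / 2) /\<^sub>R \<bar>sqrt (2 * u)\<bar>)
      = sqrt pi * (exp (- x\<^sup>2 / (4 * u)) / sqrt u)"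
    using u by (simp add: t_def power_divide real_sqrt_mult divide_simps)
  ultimately show ?thesis by simp
qed

text \<open>
  Kernels need not be of the form \<open>f (x - y)\<close>, which allows multiplication by functions of
  single coordinates and points taken from the space of a measure.
\<close>

definition pd_kernel :: "'a set \<Rightarrow> ('a \<Rightarrow> 'a \<Rightarrow> real) \<Rightarrow> bool" where
  "pd_kernel S K \<longleftrightarrow>
     (\<forall>(N::nat) (a :: nat \<Rightarrow> real) x. (\<forall>k<N. x k \<in> S) \<longrightarrow>
        (\<Sum>k<N. \<Sum>h<N. a k * K (x k) (x h) * a h) \<ge> 0)"

lemma pd_kernelD:
  "pd_kernel S K \<Longrightarrow> (\<And>k. k < N \<Longrightarrow> x k \<in> S) \<Longrightarrow> (\<Sum>k<N. \<Sum>h<N. a k * K (x k) (x h) * a h) \<ge> 0"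
  for N :: nat and a :: "nat \<Rightarrow> real"
  unfolding pd_kernel_def by blast

lemma pd_kernelI:
  "(\<And>(N::nat) (a :: nat \<Rightarrow> real) x. (\<And>k. k < N \<Longrightarrow> x k \<in> S) \<Longrightarrow>
     (\<Sum>k<N. \<Sum>h<N. a k * K (x k) (x h) * a h) \<ge> 0) \<Longrightarrow> pd_kernel S K"
  unfolding pd_kernel_def by blast

lemma positive_definite_iff_pd_kernel:
  "positive_definite d f \<longleftrightarrow> pd_kernel (Rd d) (\<lambda>x y. f (x - y))"
  by (simp add: positive_definite_def pd_kernel_def)

lemma pd_kernel_one: "pd_kernel S (\<lambda>x y. 1)"
proof (rule pd_kernelI)
  fix N :: nat and a :: "nat \<Rightarrow> real"
  have "(\<Sum>k<N. \<Sum>h<N. a k * 1 * a h) = (\<Sum>k<N. a k)\<^sup>2"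
    by (simp add: power2_eq_square sum_product)
  then show "(\<Sum>k<N. \<Sum>h<N. a k * 1 * a h) \<ge> 0" by simp
qed

lemma pd_kernel_add:
  assumes K: "pd_kernel S K" and L: "pd_kernel S L"
  shows "pd_kernel S (\<lambda>x y. K x y + L x y)"
proof (rule pd_kernelI)
  fix N :: nat and a :: "nat \<Rightarrow> real" and x
  assume x: "\<And>k. k < N \<Longrightarrow> x k \<in> S"
  have "(\<Sum>k<N. \<Sum>h<N. a k * (K (x k) (x h) + L (x k) (x h)) * a h)
      = (\<Sum>k<N. \<Sum>h<N. a k * K (x k) (x h) * a h) + (\<Sum>k<N. \<Sum>h<N. a k * L (x k) (x h) * a h)"
    by (simp add: algebra_simps sum.distrib)
  then show "(\<Sum>k<N. \<Sum>h<N. a k * (K (x k) (x h) + L (x k) (x h)) * a h) \<ge> 0"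
    using pd_kernelD[OF K x] pd_kernelD[OF L x] by simp
qed

lemma pd_kernel_scale:
  assumes K: "pd_kernel S K" and c: "c \<ge> 0"
  shows "pd_kernel S (\<lambda>x y. c * K x y)"
proof (rule pd_kernelI)
  fix N :: nat and a :: "nat \<Rightarrow> real" and x
  assume x: "\<And>k. k < N \<Longrightarrow> x k \<in> S"
  have "(\<Sum>k<N. \<Sum>h<N. a k * (c * K (x k) (x h)) * a h)
      = c * (\<Sum>k<N. \<Sum>h<N. a k * K (x k) (x h) * a h)"
    by (simp add: sum_distrib_left mult_ac)
  then show "(\<Sum>k<N. \<Sum>h<N. a k * (c * K (x k) (x h)) * a h) \<ge> 0"
    using pd_kernelD[OF K x] c by simp
qed

lemma pd_kernel_integral:
  assumes K: "\<And>s. s \<in> space M \<Longrightarrow> pd_kernel S (K s)"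
    and int: "\<And>x y. x \<in> S \<Longrightarrow> y \<in> S \<Longrightarrow> integrable M (\<lambda>s. K s x y)"
  shows "pd_kernel S (\<lambda>x y. \<integral>s. K s x y \<partial>M)"
proof (rule pd_kernelI)
  fix N :: nat and a :: "nat \<Rightarrow> real" and x
  assume x: "\<And>k. k < N \<Longrightarrow> x k \<in> S"
  have "(\<Sum>k<N. \<Sum>h<N. a k * (\<integral>s. K s (x k) (x h) \<partial>M) * a h)
      = (\<integral>s. (\<Sum>k<N. \<Sum>h<N. a k * K s (x k) (x h) * a h) \<partial>M)"
  proof -
    have i: "integrable M (\<lambda>s. a k * K s (x k) (x h) * a h)" if "k < N" "h < N" for k h
      using int[OF x[OF that(1)] x[OF that(2)]] by simp
    have "(\<integral>s. (\<Sum>k<N. \<Sum>h<N. a k * K s (x k) (x h) * a h) \<partial>M)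
        = (\<Sum>k<N. \<integral>s. (\<Sum>h<N. a k * K s (x k) (x h) * a h) \<partial>M)"
      by (intro Bochner_Integration.integral_sum Bochner_Integration.integrable_sum i) auto
    also have "\<dots> = (\<Sum>k<N. \<Sum>h<N. \<integral>s. a k * K s (x k) (x h) * a h \<partial>M)"
      by (intro sum.cong refl Bochner_Integration.integral_sum i) auto
    finally show ?thesis by simp
  qed
  also have "\<dots> \<ge> 0"
    by (intro integral_nonneg_AE AE_I2 pd_kernelD[OF K]) (auto simp: x)
  finally show "(\<Sum>k<N. \<Sum>h<N. a k * (\<integral>s. K s (x k) (x h) \<partial>M) * a h) \<ge> 0" .
qed

text \<open>
  The addition theorem writes \<open>cos (g x - g y)\<close> as
  \<open>cos (g x) cos (g y) + sin (g x) sin (g y)\<close>; each summand only changes the coefficients \<open>a k\<close>.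
\<close>

lemma pd_kernel_mult_cos:
  assumes K: "pd_kernel S K"
  shows "pd_kernel S (\<lambda>x y. K x y * cos (g x - g y))"
proof (rule pd_kernelI)
  fix N :: nat and a :: "nat \<Rightarrow> real" and x
  assume x: "\<And>k. k < N \<Longrightarrow> x k \<in> S"
  have "(\<Sum>k<N. \<Sum>h<N. a k * (K (x k) (x h) * cos (g (x k) - g (x h))) * a h)
      = (\<Sum>k<N. \<Sum>h<N. (a k * cos (g (x k))) * K (x k) (x h) * (a h * cos (g (x h))))
      + (\<Sum>k<N. \<Sum>h<N. (a k * sin (g (x k))) * K (x k) (x h) * (a h * sin (g (x h))))"
    unfolding sum.distrib[symmetric] by (intro sum.cong refl) (simp add: cos_diff algebra_simps)
  also have "\<dots> \<ge> 0"
    by (intro add_nonneg_nonneg pd_kernelD[OF K x])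
  finally show "(\<Sum>k<N. \<Sum>h<N. a k * (K (x k) (x h) * cos (g (x k) - g (x h))) * a h) \<ge> 0" .
qed

text \<open>
  This plays the role of the Schur product theorem: a factor with nonnegative one-dimensional
  Fourier transform is a mixture of cosines. Iterating it over the coordinates replaces
  multivariate Fourier analysis.
\<close>

lemma pd_kernel_mult_fourier:
  assumes K: "pd_kernel S K"
    and \<rho>: "\<And>z. \<rho> z \<ge> 0"
    and F: "\<And>t. has_bochner_integral lborel (\<lambda>z. \<rho> z * cos (z * t)) (F t)"
  shows "pd_kernel S (\<lambda>x y. K x y * F (g x - g y))"
proof -
  have pd: "pd_kernel S (\<lambda>x y. \<rho> z * (K x y * cos (z * g x - z * g y)))" for z
    by (intro pd_kernel_scale pd_kernel_mult_cos K \<rho>)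
  have int: "has_bochner_integral lborel (\<lambda>z. \<rho> z * (K x y * cos (z * g x - z * g y))) (K x y * F (g x - g y))"
    for x y
    using has_bochner_integral_mult_right[OF F[of "g x - g y"], of "K x y"] by (simp add: algebra_simps)
  have "pd_kernel S (\<lambda>x y. \<integral>z. \<rho> z * (K x y * cos (z * g x - z * g y)) \<partial>lborel)"
    using int by (intro pd_kernel_integral pd) (auto simp: has_bochner_integral_iff)
  then show ?thesis
    by (simp only: int[THEN has_bochner_integral_integral_eq])
qed

text \<open>
  The one-dimensional heat kernel at time \<open>u\<close> without the factor \<open>1 / sqrt (4 pi)\<close>. The factor
  \<open>1 / sqrt u\<close> is what makes its Fourier transform decrease in \<open>u\<close>.
\<close>

definition heat :: "real \<Rightarrow> real \<Rightarrow> real" where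
  "heat u r = exp (- r\<^sup>2 / (4 * u)) / sqrt u"

lemma pd_kernel_mult_heat:
  assumes "pd_kernel S K" "u > 0"
  shows "pd_kernel S (\<lambda>x y. K x y * heat u (g x - g y))"
proof -
  have "has_bochner_integral lborel (\<lambda>z. exp (- u * z\<^sup>2) / sqrt pi * cos (z * t)) (heat u t)" for t
    using has_bochner_integral_mult_right[OF gaussian_fourier[OF assms(2), of t], of "1 / sqrt pi"]
    by (simp add: heat_def)
  then show ?thesis
    by (rule pd_kernel_mult_fourier[OF assms(1), rotated]) simp
qed

text \<open>
  The Fourier transform of the difference is \<open>exp(-u z\<^sup>2) - exp(-v z\<^sup>2)\<close> up to a positive factor, and
  this is nonnegative for \<open>u \<le> v\<close>.
\<close>

lemma pd_kernel_mult_heat_diff: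
  assumes "pd_kernel S K" "0 < u" "u \<le> v"
  shows "pd_kernel S (\<lambda>x y. K x y * (heat u (g x - g y) - heat v (g x - g y)))"
proof -
  have "has_bochner_integral lborel
      (\<lambda>z. (exp (- u * z\<^sup>2) - exp (- v * z\<^sup>2)) / sqrt pi * cos (z * t)) (heat u t - heat v t)" for t
    using has_bochner_integral_mult_right[OF has_bochner_integral_diff[OF
        gaussian_fourier[of u t] gaussian_fourier[of v t]], of "1 / sqrt pi"] assms(2,3)
    by (simp add: heat_def algebra_simps diff_divide_distrib)
  then show ?thesis
    by (rule pd_kernel_mult_fourier[OF assms(1), rotated]) (use assms(3) in \<open>auto intro!: divide_nonneg_nonneg mult_right_mono\<close>)
qed

lemma pd_kernel_heat_prod:
  assumes "u > 0"
  shows "pd_kernel S (\<lambda>x y :: nat \<Rightarrow> real. \<Prod>i<d. heat u (x i - y i))"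
proof (induction d)
  case (Suc d)
  show ?case
    using pd_kernel_mult_heat[OF Suc assms, of "\<lambda>x. x d"] by simp
qed (simp add: pd_kernel_one)

text \<open>
  The one-dimensional comparison is lifted to \<open>d\<close> coordinates by telescoping:
  \<open>P h\<^sub>u - Q h\<^sub>v = P (h\<^sub>u - h\<^sub>v) + (P - Q) h\<^sub>v\<close>, where \<open>P, Q\<close> are the products over the earlier coordinates.
\<close>

lemma pd_kernel_heat_prod_diff:
  assumes uv: "0 < u" "u \<le> v"
  shows "pd_kernel S (\<lambda>x y :: nat \<Rightarrow> real. (\<Prod>i<d. heat u (x i - y i)) - (\<Prod>i<d. heat v (x i - y i)))"
proof (induction d)
  case 0
  show ?case using pd_kernel_scale[OF pd_kernel_one, of 0] by simp
next
  case (Suc d)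
  have "pd_kernel S (\<lambda>x y. (\<Prod>i<d. heat u (x i - y i)) * (heat u (x d - y d) - heat v (x d - y d))
      + ((\<Prod>i<d. heat u (x i - y i)) - (\<Prod>i<d. heat v (x i - y i))) * heat v (x d - y d))"
    using uv
    by (intro pd_kernel_add pd_kernel_mult_heat_diff pd_kernel_heat_prod pd_kernel_mult_heat Suc) auto
  then show ?case
    by (simp add: algebra_simps)
qed

lemma prod_heat_eq:
  assumes "u > 0"
  shows "(\<Prod>i<d. heat u (x i - y i)) = u powr (- real d / 2) * exp (- (L2_set (x - y) {..<d})\<^sup>2 / (4 * u))"
proof -
  have "(\<Prod>i<d. heat u (x i - y i)) = exp (\<Sum>i<d. - (x i - y i)\<^sup>2 / (4 * u)) / sqrt u ^ d"
    by (simp add: heat_def prod_dividef exp_sum)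
  also have "(\<Sum>i<d. - (x i - y i)\<^sup>2 / (4 * u)) = - (L2_set (x - y) {..<d})\<^sup>2 / (4 * u)"
    by (simp add: L2_set_def sum_nonneg sum_negf flip: sum_divide_distrib)
  also have "sqrt u ^ d = u powr (real d / 2)"
  proof -
    have "sqrt u ^ d = (u powr (1 / 2)) powr real d"
      using assms by (simp only: powr_half_sqrt less_imp_le powr_realpow real_sqrt_gt_zero)
    also have "\<dots> = u powr (real d / 2)"
      unfolding powr_powr by simp
    finally show ?thesis .
  qed
  also have "exp (- (L2_set (x - y) {..<d})\<^sup>2 / (4 * u)) / u powr (real d / 2)
      = u powr (- real d / 2) * exp (- (L2_set (x - y) {..<d})\<^sup>2 / (4 * u))"
    unfolding minus_divide_left[of "real d", symmetric] powr_minus_divide by (simp only: times_divide_eq_left mult_1_left)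
  finally show ?thesis .
qed

section \<open>The Matern function as a Gaussian mixture\<close>

text \<open>
  The unnormalized Gamma density, extended by zero so that all integrals run over the real line.
\<close>

definition gamma_weight :: "real \<Rightarrow> real \<Rightarrow> real" where
  "gamma_weight a s = indicator {0<..} s * s powr (a - 1) * exp (- s)"

lemma gamma_weight_nonneg: "gamma_weight a s \<ge> 0"
  by (simp add: gamma_weight_def)

lemma gamma_weight_measurable [measurable]: "gamma_weight a \<in> borel_measurable borel"
  unfolding gamma_weight_def[abs_def] by measurable

lemma gamma_weight_integral:
  assumes "a > 0"
  shows "has_bochner_integral lborel (gamma_weight a) (Gamma a)"
proof -
  have "(\<integral>\<^sup>+s. ennreal (gamma_weight a s) \<partial>lborel)
      = (\<integral>\<^sup>+s. ennreal (indicator {0..} s * s powr (a - 1) / exp s) \<partial>lborel)"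
    by (intro nn_integral_cong) (auto simp: gamma_weight_def indicator_def exp_minus divide_inverse)
  also have "\<dots> = ennreal (Gamma a)"
    by (rule Gamma_conv_nn_integral_real[OF assms, symmetric])
  finally show ?thesis
    using assms by (intro has_bochner_integral_nn_integral) (auto simp: gamma_weight_nonneg Gamma_real_pos less_imp_le)
qed

lemma gamma_weight_scaled_integral:
  fixes a c :: real
  assumes a: "a > 0" and c: "c > 0"
  shows "has_bochner_integral lborel (\<lambda>s. indicator {0<..} s * s powr (a - 1) * exp (- c * s))
           (Gamma a * c powr (- a))"
proof -
  have "has_bochner_integral lborel (\<lambda>s. gamma_weight a (0 + c * s)) (Gamma a /\<^sub>R \<bar>c\<bar>)"
    using gamma_weight_integral[OF a] c
    by (subst (asm) lborel_has_bochner_integral_real_affine_iff[where c = c and t = 0]) auto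
  then have "has_bochner_integral lborel (\<lambda>s. c powr (1 - a) * gamma_weight a (0 + c * s))
      (c powr (1 - a) * (Gamma a /\<^sub>R \<bar>c\<bar>))"
    by (rule has_bochner_integral_mult_right)
  moreover have "c powr (1 - a) * gamma_weight a (0 + c * s)
      = indicator {0<..} s * s powr (a - 1) * exp (- c * s)" for s
  proof (cases "s > 0")
    case True
    have "c powr (1 - a) * c powr (a - 1) = 1"
      using c by (simp add: powr_add[symmetric])
    then show ?thesis
      using True c by (simp add: gamma_weight_def powr_mult)
  next
    case False
    then show ?thesis
      using c by (auto simp: gamma_weight_def indicator_def zero_less_mult_iff)
  qed
  moreover have "c powr (1 - a) * (Gamma a /\<^sub>R \<bar>c\<bar>) = Gamma a * c powr (- a)"
  proof -
    have "c powr (1 - a) * inverse c = c powr (- a)"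
      using c by (simp add: powr_diff powr_minus field_simps)
    then show ?thesis using c by simp
  qed
  ultimately show ?thesis by (simp only:)
qed

text \<open>
  The substitution \<open>s = (t/2) exp w\<close> turns \<open>s + t\<^sup>2 / 4s\<close> into \<open>t cosh w\<close> and \<open>s powr (\<nu> - 1) ds\<close> into
  \<open>(t/2) powr \<nu> exp (\<nu> w) dw\<close>; symmetrizing in \<open>w\<close> then yields the integral that defines \<open>bessel_K\<close>.
\<close>

lemma bessel_K_substitution:
  assumes \<nu>: "\<nu> > 0" and t: "t > 0"
  shows "(\<integral>s. gamma_weight \<nu> s * exp (- t\<^sup>2 / (4 * s)) \<partial>lborel) = 2 * (t / 2) powr \<nu> * bessel_K \<nu> t"
proof -
  define f where "f s = gamma_weight \<nu> s * exp (- t\<^sup>2 / (4 * s))" for s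
  define F where "F w = (t / 2) powr \<nu> * (exp (\<nu> * w) * exp (- t * cosh w))" for w
  define E where "E w = exp (- t * cosh w) * cosh (\<nu> * w)" for w
  define g where "g w = t / 2 * exp w" for w
  have f_int: "integrable lborel f"
  proof (rule Bochner_Integration.integrable_bound)
    show "integrable lborel (gamma_weight \<nu>)"
      using gamma_weight_integral[OF \<nu>] by (simp add: has_bochner_integral_iff)
    show "f \<in> borel_measurable lborel"
      unfolding f_def[abs_def] by measurable
    show "AE s in lborel. norm (f s) \<le> norm (gamma_weight \<nu> s)"
      by (intro AE_I2) (auto simp: f_def gamma_weight_def indicator_def divide_nonpos_pos intro!: mult_left_le)
  qed
  have range_g: "range g = {0<..}"
  proof safe
    fix s :: real assume "s > 0"
    then have "s = g (ln (2 * s / t))" using t by (simp add: g_def)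
    then show "s \<in> range g" by blast
  qed (use t in \<open>simp add: g_def\<close>)
  have fg: "\<bar>g w\<bar> * f (g w) = F w" for w
  proof -
    have gp: "g w > 0" using t by (simp add: g_def)
    have "g w * g w powr (\<nu> - 1) = g w powr \<nu>"
      using gp by (simp add: powr_diff)
    also have "g w powr \<nu> = (t / 2) powr \<nu> * exp (\<nu> * w)"
      unfolding g_def using t by (subst powr_mult) (auto simp: powr_def)
    finally have p: "g w * g w powr (\<nu> - 1) = (t / 2) powr \<nu> * exp (\<nu> * w)" .
    have "- g w + - t\<^sup>2 / (4 * g w) = - t * cosh w"
      using t by (simp add: g_def cosh_def exp_minus field_simps power2_eq_square)
    then have e: "exp (- g w) * exp (- t\<^sup>2 / (4 * g w)) = exp (- t * cosh w)"
      by (simp only: mult_exp_exp)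
    have "\<bar>g w\<bar> * f (g w)
        = (g w * g w powr (\<nu> - 1)) * (exp (- g w) * exp (- t\<^sup>2 / (4 * g w)))"
      using gp by (simp add: f_def gamma_weight_def)
    also have "\<dots> = F w"
      unfolding p e by (simp add: F_def)
    finally show ?thesis .
  qed
  have "f absolutely_integrable_on {0<..}"
    by (rule set_integrable_subset[of _ UNIV])
       (use f_int in \<open>auto simp: set_integrable_def integrable_completion\<close>)
  moreover have "integral {0<..} f = (\<integral>s. f s \<partial>lborel)"
  proof -
    have "(f has_integral (\<integral>s. f s \<partial>lborel)) UNIV"
      by (rule has_integral_integral_lborel[OF f_int])
    moreover have "(\<lambda>s. if s \<in> {0<..} then f s else 0) = f"
      by (auto simp: f_def gamma_weight_def fun_eq_iff)
    ultimately have "(f has_integral (\<integral>s. f s \<partial>lborel)) {0<..}"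
      using has_integral_restrict_UNIV[of "{0<..}" f] by simp
    then show ?thesis by (rule integral_unique)
  qed
  ultimately have "(\<lambda>w. \<bar>g w\<bar> * f (g w)) absolutely_integrable_on UNIV \<and>
      integral UNIV (\<lambda>w. \<bar>g w\<bar> * f (g w)) = (\<integral>s. f s \<partial>lborel)"
    unfolding range_g[symmetric]
  proof (subst has_absolute_integral_change_of_variables_1'[where g = g and g' = g])
    show "(g has_field_derivative g w) (at w within UNIV)" for w
      unfolding g_def[abs_def] by (auto intro!: derivative_eq_intros)
    show "inj g"
      using t by (auto simp: g_def inj_on_def)
  qed auto
  then have F: "F absolutely_integrable_on UNIV" "integral UNIV F = (\<integral>s. f s \<partial>lborel)"
    by (simp_all add: fg)
  have F_meas [measurable]: "F \<in> borel_measurable borel"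
    unfolding F_def[abs_def] cosh_def by measurable
  have F_int: "integrable lborel F"
    using F(1) by (simp add: set_integrable_def integrable_completion)
  have F_val: "(\<integral>w. F w \<partial>lborel) = (\<integral>s. f s \<partial>lborel)"
    using F(2) integral_lborel[OF F_int] by simp
  have Fm_int: "integrable lborel (\<lambda>w. F (- w))"
    using lborel_integrable_real_affine[OF F_int, of "-1" 0] by simp
  have Fm_val: "(\<integral>w. F (- w) \<partial>lborel) = (\<integral>w. F w \<partial>lborel)"
    using lborel_integral_real_affine[of "-1" F 0] by simp
  have FE: "F w + F (- w) = 2 * (t / 2) powr \<nu> * E w" for w
    by (simp add: F_def E_def cosh_def[of "\<nu> * w"] algebra_simps)
  have tp: "(t / 2) powr \<nu> > 0" using t by simp
  have "integrable lborel (\<lambda>w. F w + F (- w))"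
    using F_int Fm_int by simp
  then have E_int: "integrable lborel E"
    using tp t by (simp add: FE)
  have "has_bochner_integral lborel (\<lambda>w. indicator {0..} w *\<^sub>R E w) (bessel_K \<nu> t)"
  proof -
    have "integrable lborel (\<lambda>w. indicator {0..} w *\<^sub>R E w)"
      by (rule integrable_mult_indicator[OF _ E_int]) simp
    moreover have "(\<integral>w. indicator {0..} w *\<^sub>R E w \<partial>lborel) = bessel_K \<nu> t"
      by (simp only: bessel_K_def set_lebesgue_integral_def E_def)
    ultimately show ?thesis by (simp only: has_bochner_integral_iff simp_thms)
  qed
  then have "has_bochner_integral lborel E (2 *\<^sub>R bessel_K \<nu> t)"
    by (rule has_bochner_integral_even_function) (simp add: E_def)
  then have "(\<integral>w. F w + F (- w) \<partial>lborel) = 2 * (t / 2) powr \<nu> * (2 * bessel_K \<nu> t)"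
    by (simp add: FE has_bochner_integral_iff)
  then have "2 * (\<integral>s. f s \<partial>lborel) = 2 * (t / 2) powr \<nu> * (2 * bessel_K \<nu> t)"
    using F_int Fm_int by (simp add: Fm_val F_val)
  then show ?thesis by (simp add: f_def)
qed

lemma gamma_weight_mult_integrable:
  assumes "\<nu> > 0" and [measurable]: "h \<in> borel_measurable borel"
    and "\<And>s. s > 0 \<Longrightarrow> \<bar>h s\<bar> \<le> C"
  shows "integrable lborel (\<lambda>s. gamma_weight \<nu> s * h s)"
proof (rule Bochner_Integration.integrable_bound)
  show "integrable lborel (\<lambda>s. gamma_weight \<nu> s * C)"
    using gamma_weight_integral[OF assms(1)] by (auto simp: has_bochner_integral_iff)
  show "AE s in lborel. norm (gamma_weight \<nu> s * h s) \<le> norm (gamma_weight \<nu> s * C)"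
  proof (intro AE_I2)
    fix s
    show "norm (gamma_weight \<nu> s * h s) \<le> norm (gamma_weight \<nu> s * C)"
    proof (cases "s > 0")
      case True
      then have "\<bar>h s\<bar> \<le> \<bar>C\<bar>" using assms(3) by fastforce
      then show ?thesis
        by (simp add: abs_mult mult_left_mono)
    qed (simp add: gamma_weight_def)
  qed
qed simp

lemma gamma_weight_gaussian_integrable:
  assumes "\<nu> > 0" "b > 0"
  shows "integrable lborel (\<lambda>s. gamma_weight \<nu> s * exp (- t\<^sup>2 / (4 * (s * b))))"
  using assms by (intro gamma_weight_mult_integrable[where C = 1]) (auto simp: divide_nonpos_pos)

text \<open>
  The normalization of the Matern function is exactly the one that makes it a mixture of Gaussians
  under the Gamma distribution of shape \<open>\<nu>\<close>; in particular the value \<open>1\<close> at \<open>t = 0\<close> fits.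
\<close>

lemma matern_gaussian_mixture:
  assumes \<nu>: "\<nu> > 0" and t: "t \<ge> 0" and \<beta>: "\<beta> > 0"
  shows "Gamma \<nu> * matern (t / \<beta>) \<nu> = (\<integral>s. gamma_weight \<nu> s * exp (- t\<^sup>2 / (4 * (s * \<beta>\<^sup>2))) \<partial>lborel)"
proof (cases "t = 0")
  case True
  then show ?thesis
    using gamma_weight_integral[OF \<nu>] by (simp add: matern_def has_bochner_integral_iff)
next
  case False
  with t \<beta> have p: "t / \<beta> > 0" by simp
  have "(\<integral>s. gamma_weight \<nu> s * exp (- t\<^sup>2 / (4 * (s * \<beta>\<^sup>2))) \<partial>lborel)
      = (\<integral>s. gamma_weight \<nu> s * exp (- (t / \<beta>)\<^sup>2 / (4 * s)) \<partial>lborel)"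
    by (simp add: power_divide mult_ac)
  also have "\<dots> = 2 * (t / \<beta> / 2) powr \<nu> * bessel_K \<nu> (t / \<beta>)"
    by (rule bessel_K_substitution[OF \<nu> p])
  also have "\<dots> = Gamma \<nu> * matern (t / \<beta>) \<nu>"
    using p \<nu> Gamma_real_pos[OF \<nu>, THEN less_imp_neq] False \<beta>
    by (simp add: matern_def powr_divide powr_diff powr_mult mult_ac)
  finally show ?thesis by simp
qed

text \<open>
  Dominated convergence in the Gaussian mixture; this covers continuity at \<open>0\<close>, where the value is set
  by hand in the definition.
\<close>

lemma continuous_on_matern:
  assumes \<nu>: "\<nu> > 0"
  shows "continuous_on {0..} (\<lambda>t. matern t \<nu>)"
proof -
  have "continuous_on {0..} (\<lambda>t. \<integral>s. gamma_weight \<nu> s * exp (- t\<^sup>2 / (4 * s)) \<partial>lborel)"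
    unfolding continuous_on_sequentially o_def
  proof (intro allI ballI impI, elim conjE)
    fix x :: "nat \<Rightarrow> real" and a
    assume "x \<longlonglongrightarrow> a"
    then show "(\<lambda>n. \<integral>s. gamma_weight \<nu> s * exp (- (x n)\<^sup>2 / (4 * s)) \<partial>lborel)
        \<longlonglongrightarrow> (\<integral>s. gamma_weight \<nu> s * exp (- a\<^sup>2 / (4 * s)) \<partial>lborel)"
    proof (intro integral_dominated_convergence[where w = "gamma_weight \<nu>"] AE_I2)
      show "integrable lborel (gamma_weight \<nu>)"
        using gamma_weight_integral[OF \<nu>] by (simp add: has_bochner_integral_iff)
      show "(\<lambda>n. gamma_weight \<nu> s * exp (- (x n)\<^sup>2 / (4 * s))) \<longlonglongrightarrow> gamma_weight \<nu> s * exp (- a\<^sup>2 / (4 * s))" for s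
        unfolding divide_inverse by (intro tendsto_intros \<open>x \<longlonglongrightarrow> a\<close>)
      show "norm (gamma_weight \<nu> s * exp (- (x n)\<^sup>2 / (4 * s))) \<le> gamma_weight \<nu> s" for n s
        by (auto simp: gamma_weight_def indicator_def divide_nonpos_pos intro!: mult_left_le)
    qed measurable
  qed
  then have "continuous_on {0..} (\<lambda>t. inverse (Gamma \<nu>) * (\<integral>s. gamma_weight \<nu> s * exp (- t\<^sup>2 / (4 * s)) \<partial>lborel))"
    by (intro continuous_intros)
  then show ?thesis
  proof (rule continuous_on_cong[OF refl, THEN iffD1, rotated])
    fix t :: real
    assume "t \<in> {0..}"
    then have "Gamma \<nu> * matern t \<nu> = (\<integral>s. gamma_weight \<nu> s * exp (- t\<^sup>2 / (4 * s)) \<partial>lborel)"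
      using matern_gaussian_mixture[OF \<nu>, of t 1] by simp
    then show "inverse (Gamma \<nu>) * (\<integral>s. gamma_weight \<nu> s * exp (- t\<^sup>2 / (4 * s)) \<partial>lborel) = matern t \<nu>"
      using Gamma_real_pos[OF \<nu>] by (simp add: field_simps)
  qed
qed

section \<open>Sufficiency\<close>

lemma pd_kernel_gaussian:
  fixes u :: real and d :: nat
  assumes u: "u > 0"
  shows "pd_kernel S (\<lambda>x y. exp (- (L2_set (x - y) {..<d})\<^sup>2 / (4 * u)))"
proof -
  have "pd_kernel S (\<lambda>x y. u powr (real d / 2) * (\<Prod>i<d. heat u (x i - y i)))"
    by (intro pd_kernel_scale pd_kernel_heat_prod u) simp
  moreover have "u powr (real d / 2) * u powr (- real d / 2) = 1"
    using u by (simp flip: powr_add)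
  ultimately show ?thesis
    by (simp add: prod_heat_eq[OF u] flip: mult.assoc)
qed

lemma pd_kernel_matern:
  fixes d :: nat
  assumes \<nu>: "\<nu> > 0" and \<beta>: "\<beta> > 0"
  shows "pd_kernel S (\<lambda>x y. matern (L2_set (x - y) {..<d} / \<beta>) \<nu>)"
proof -
  let ?g = "\<lambda>s x y. gamma_weight \<nu> s * exp (- (L2_set (x - y) {..<d})\<^sup>2 / (4 * (s * \<beta>\<^sup>2)))"
  have pd: "pd_kernel S (?g s)" for s
  proof (cases "s > 0")
    case True
    then show ?thesis
      using \<beta> by (intro pd_kernel_scale[OF pd_kernel_gaussian gamma_weight_nonneg]) simp
  next
    case False
    then show ?thesis
      using pd_kernel_scale[OF pd_kernel_one, of 0] by (simp add: gamma_weight_def)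
  qed
  have "pd_kernel S (\<lambda>x y. \<integral>s. ?g s x y \<partial>lborel)"
    by (intro pd_kernel_integral pd gamma_weight_gaussian_integrable) (use \<nu> \<beta> in auto)
  then have "pd_kernel S (\<lambda>x y. inverse (Gamma \<nu>) * (\<integral>s. ?g s x y \<partial>lborel))"
    by (rule pd_kernel_scale) (use Gamma_real_pos[OF \<nu>] in simp)
  moreover have "inverse (Gamma \<nu>) * (Gamma \<nu> * m) = m" for m
    using Gamma_real_pos[OF \<nu>] by simp
  ultimately show ?thesis
    by (simp only: matern_gaussian_mixture[OF \<nu> L2_set_nonneg \<beta>, symmetric])
qed

text \<open>
  For \<open>s > 0\<close> the integrand \<open>\<beta> powr (-d) exp(-\<parallel>x\<parallel>\<^sup>2 / (4 s \<beta>\<^sup>2))\<close> is \<open>s powr (d/2)\<close> times the heat kernel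
  at time \<open>s \<beta>\<^sup>2\<close>, and heat kernels decrease in time. This is the boundary case \<open>\<epsilon> = -d\<close>.
\<close>

lemma pd_kernel_matern_normalized_antimono:
  assumes \<nu>: "\<nu> > 0" and \<beta>1: "0 < \<beta>1" and \<beta>12: "\<beta>1 \<le> \<beta>2"
  shows "pd_kernel S (\<lambda>x y.
           \<beta>1 powr (- real d) * matern (L2_set (x - y) {..<d} / \<beta>1) \<nu>
         - \<beta>2 powr (- real d) * matern (L2_set (x - y) {..<d} / \<beta>2) \<nu>)"
proof -
  have \<beta>2: "\<beta>2 > 0" using \<beta>1 \<beta>12 by simp
  let ?e = "\<lambda>\<beta> s x y. exp (- (L2_set (x - y) {..<d})\<^sup>2 / (4 * (s * \<beta>\<^sup>2)))"
  let ?g = "\<lambda>s x y. \<beta>1 powr (- real d) * (gamma_weight \<nu> s * ?e \<beta>1 s x y)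
                  - \<beta>2 powr (- real d) * (gamma_weight \<nu> s * ?e \<beta>2 s x y)"
  have pd: "pd_kernel S (?g s)" for s
  proof (cases "s > 0")
    case True
    have scaled: "s powr (real d / 2) * (\<Prod>i<d. heat (s * \<beta>\<^sup>2) (x i - y i)) = \<beta> powr (- real d) * ?e \<beta> s x y"
      if \<beta>: "\<beta> > 0" for \<beta> x y
    proof -
      have "(s * \<beta>\<^sup>2) powr (- real d / 2) = s powr (- real d / 2) * (\<beta>\<^sup>2) powr (- real d / 2)"
        using True \<beta> by (simp add: powr_mult)
      also have "(\<beta>\<^sup>2) powr (- real d / 2) = \<beta> powr (- real d)"
        using \<beta> powr_powr[of \<beta> 2 "- real d / 2"] by (simp add: powr_numeral)
      finally have "s powr (real d / 2) * (s * \<beta>\<^sup>2) powr (- real d / 2)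
          = (s powr (real d / 2) * s powr (- real d / 2)) * \<beta> powr (- real d)"
        by (simp only: mult.assoc)
      also have "s powr (real d / 2) * s powr (- real d / 2) = 1"
        using True by (simp flip: powr_add)
      finally show ?thesis
        using True \<beta> by (simp only: prod_heat_eq zero_less_power mult_pos_pos mult_1_left mult.assoc[symmetric])
    qed
    have "pd_kernel S (\<lambda>x y. gamma_weight \<nu> s * (s powr (real d / 2) *
        ((\<Prod>i<d. heat (s * \<beta>1\<^sup>2) (x i - y i)) - (\<Prod>i<d. heat (s * \<beta>2\<^sup>2) (x i - y i)))))"
      using True \<beta>1 \<beta>12
      by (intro pd_kernel_scale pd_kernel_heat_prod_diff gamma_weight_nonneg mult_left_mono power_mono) auto
    then show ?thesis
      unfolding right_diff_distrib[of "s powr (real d / 2)"] scaled[OF \<beta>1] scaled[OF \<beta>2]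
      by (simp add: algebra_simps)
  next
    case False
    then show ?thesis
      using pd_kernel_scale[OF pd_kernel_one, of 0] by (simp add: gamma_weight_def)
  qed
  have int: "integrable lborel (\<lambda>s. gamma_weight \<nu> s * ?e \<beta> s x y)" if "\<beta> > 0" for \<beta> x y
    using that \<nu> by (intro gamma_weight_gaussian_integrable) auto
  have "pd_kernel S (\<lambda>x y. \<integral>s. ?g s x y \<partial>lborel)"
    by (intro pd_kernel_integral pd Bochner_Integration.integrable_diff integrable_mult_right int \<beta>1 \<beta>2)
  then have "pd_kernel S (\<lambda>x y. inverse (Gamma \<nu>) * (\<integral>s. ?g s x y \<partial>lborel))"
    by (rule pd_kernel_scale) (use Gamma_real_pos[OF \<nu>] in simp)
  moreover have "inverse (Gamma \<nu>) * (\<integral>s. ?g s x y \<partial>lborel)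
      = \<beta>1 powr (- real d) * matern (L2_set (x - y) {..<d} / \<beta>1) \<nu>
      - \<beta>2 powr (- real d) * matern (L2_set (x - y) {..<d} / \<beta>2) \<nu>" for x y
  proof -
    have "(\<integral>s. ?g s x y \<partial>lborel)
        = \<beta>1 powr (- real d) * (Gamma \<nu> * matern (L2_set (x - y) {..<d} / \<beta>1) \<nu>)
        - \<beta>2 powr (- real d) * (Gamma \<nu> * matern (L2_set (x - y) {..<d} / \<beta>2) \<nu>)"
      unfolding matern_gaussian_mixture[OF \<nu> L2_set_nonneg \<beta>1] matern_gaussian_mixture[OF \<nu> L2_set_nonneg \<beta>2]
      using int[OF \<beta>1] int[OF \<beta>2] by (subst Bochner_Integration.integral_diff) auto
    then show ?thesis
      using Gamma_real_pos[OF \<nu>] by (simp add: field_simps)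
  qed
  ultimately show ?thesis by (simp only:)
qed

text \<open>
  The substitution \<open>u = s \<beta>\<^sup>2\<close> moves \<open>\<beta>\<close> from the Gaussian into the mixing density, so that Matern
  functions with different \<open>\<beta>\<close> become mixtures of the same Gaussians.
\<close>

lemma matern_rescaled_mixture:
  assumes \<nu>: "\<nu> > 0" and t: "t \<ge> 0" and \<beta>: "\<beta> > 0"
  shows "has_bochner_integral lborel
           (\<lambda>u. indicator {0<..} u * u powr (\<nu> - 1) * exp (- u / \<beta>\<^sup>2) * exp (- t\<^sup>2 / (4 * u)))
           (Gamma \<nu> * (\<beta> powr (2 * \<nu>) * matern (t / \<beta>) \<nu>))"
proof -
  define f where "f s = gamma_weight \<nu> s * exp (- t\<^sup>2 / (4 * (s * \<beta>\<^sup>2)))" for s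
  have b2: "\<beta>\<^sup>2 > 0" using \<beta> by simp
  have bp: "\<beta> powr (2 * \<nu>) = (\<beta>\<^sup>2) powr \<nu>"
    using \<beta> powr_powr[of \<beta> 2 \<nu>] by (simp add: powr_numeral)
  have "has_bochner_integral lborel f (Gamma \<nu> * matern (t / \<beta>) \<nu>)"
    using gamma_weight_gaussian_integrable[OF \<nu> b2, of t] matern_gaussian_mixture[OF \<nu> t \<beta>]
    by (simp add: f_def[abs_def] has_bochner_integral_iff)
  then have "has_bochner_integral lborel (\<lambda>u. f (0 + 1 / \<beta>\<^sup>2 * u)) ((Gamma \<nu> * matern (t / \<beta>) \<nu>) /\<^sub>R \<bar>1 / \<beta>\<^sup>2\<bar>)"
    using b2 by (subst (asm) lborel_has_bochner_integral_real_affine_iff[where c = "1 / \<beta>\<^sup>2" and t = 0]) auto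
  then have "has_bochner_integral lborel (\<lambda>u. (\<beta>\<^sup>2) powr (\<nu> - 1) * f (0 + 1 / \<beta>\<^sup>2 * u))
      ((\<beta>\<^sup>2) powr (\<nu> - 1) * ((Gamma \<nu> * matern (t / \<beta>) \<nu>) /\<^sub>R \<bar>1 / \<beta>\<^sup>2\<bar>))"
    by (rule has_bochner_integral_mult_right)
  moreover have "(\<beta>\<^sup>2) powr (\<nu> - 1) * f (0 + 1 / \<beta>\<^sup>2 * u)
      = indicator {0<..} u * u powr (\<nu> - 1) * exp (- u / \<beta>\<^sup>2) * exp (- t\<^sup>2 / (4 * u))" for u
  proof (cases "u > 0")
    case True
    have "(\<beta>\<^sup>2) powr (\<nu> - 1) * (u / \<beta>\<^sup>2) powr (\<nu> - 1) = u powr (\<nu> - 1)"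
      using b2 True by (subst powr_mult[symmetric]) auto
    then show ?thesis
      using True b2 by (simp add: f_def gamma_weight_def)
  next
    case False
    then show ?thesis
      using b2 by (auto simp: f_def gamma_weight_def indicator_def zero_less_divide_iff)
  qed
  moreover have "(\<beta>\<^sup>2) powr (\<nu> - 1) * ((Gamma \<nu> * matern (t / \<beta>) \<nu>) /\<^sub>R \<bar>1 / \<beta>\<^sup>2\<bar>)
      = Gamma \<nu> * (\<beta> powr (2 * \<nu>) * matern (t / \<beta>) \<nu>)"
    unfolding bp using b2 by (simp add: powr_diff)
  ultimately show ?thesis by (simp only:)
qed

text \<open>
  In the rescaled mixture the weight \<open>exp(-u / \<beta>\<^sup>2)\<close> of each Gaussian increases with \<open>\<beta>\<close>. This is the
  boundary case \<open>\<epsilon> = 2\<nu>\<close>.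
\<close>

lemma pd_kernel_matern_weighted_mono:
  fixes d :: nat
  assumes \<nu>: "\<nu> > 0" and \<beta>1: "0 < \<beta>1" and \<beta>12: "\<beta>1 \<le> \<beta>2"
  shows "pd_kernel S (\<lambda>x y.
           \<beta>2 powr (2 * \<nu>) * matern (L2_set (x - y) {..<d} / \<beta>2) \<nu>
         - \<beta>1 powr (2 * \<nu>) * matern (L2_set (x - y) {..<d} / \<beta>1) \<nu>)"
proof -
  have \<beta>2: "\<beta>2 > 0" using \<beta>1 \<beta>12 by simp
  let ?h = "\<lambda>\<beta> u x y. indicator {0<..} u * u powr (\<nu> - 1) * exp (- u / \<beta>\<^sup>2)
              * exp (- (L2_set (x - y) {..<d})\<^sup>2 / (4 * u))"
  note mix = matern_rescaled_mixture[OF \<nu> L2_set_nonneg]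
  have pd: "pd_kernel S (\<lambda>x y. ?h \<beta>2 u x y - ?h \<beta>1 u x y)" for u
  proof (cases "u > 0")
    case True
    have "exp (- u / \<beta>1\<^sup>2) \<le> exp (- u / \<beta>2\<^sup>2)"
      using True \<beta>1 \<beta>12 by (auto intro!: divide_left_mono power_mono)
    then have "pd_kernel S (\<lambda>x y. (u powr (\<nu> - 1) * (exp (- u / \<beta>2\<^sup>2) - exp (- u / \<beta>1\<^sup>2)))
        * exp (- (L2_set (x - y) {..<d})\<^sup>2 / (4 * u)))"
      by (intro pd_kernel_scale[OF pd_kernel_gaussian[OF True]]) simp
    then show ?thesis
      using True by (simp add: algebra_simps)
  next
    case False
    then show ?thesis
      using pd_kernel_scale[OF pd_kernel_one, of 0] by simp
  qed
  have "pd_kernel S (\<lambda>x y. \<integral>u. ?h \<beta>2 u x y - ?h \<beta>1 u x y \<partial>lborel)"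
    by (intro pd_kernel_integral pd Bochner_Integration.integrable_diff
          integrable.intros[OF mix[OF \<beta>1]] integrable.intros[OF mix[OF \<beta>2]])
  then have "pd_kernel S (\<lambda>x y. inverse (Gamma \<nu>) * (\<integral>u. ?h \<beta>2 u x y - ?h \<beta>1 u x y \<partial>lborel))"
    by (rule pd_kernel_scale) (use Gamma_real_pos[OF \<nu>] in simp)
  moreover have "inverse (Gamma \<nu>) * (\<integral>u. ?h \<beta>2 u x y - ?h \<beta>1 u x y \<partial>lborel)
      = \<beta>2 powr (2 * \<nu>) * matern (L2_set (x - y) {..<d} / \<beta>2) \<nu>
      - \<beta>1 powr (2 * \<nu>) * matern (L2_set (x - y) {..<d} / \<beta>1) \<nu>" for x y
    unfolding has_bochner_integral_integral_eq[OF has_bochner_integral_diff[OF mix[OF \<beta>2] mix[OF \<beta>1]]]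
    using Gamma_real_pos[OF \<nu>] by (simp add: field_simps)
  ultimately show ?thesis by (simp only:)
qed

lemma K_op_matern_in_Phi:
  assumes \<nu>: "\<nu> > 0" and \<beta>: "0 < \<beta>1" "\<beta>1 < \<beta>2" and ne: "\<beta>2 powr \<epsilon> \<noteq> \<beta>1 powr \<epsilon>"
    and pd: "pd_kernel (Rd d) (\<lambda>x y. K_op \<epsilon> \<nu> \<beta>2 \<beta>1 matern (L2_set (x - y) {..<d}))"
  shows "K_op \<epsilon> \<nu> \<beta>2 \<beta>1 matern \<in> Phi d"
proof -
  have "K_op \<epsilon> \<nu> \<beta>2 \<beta>1 matern 0 = 1"
    using ne by (simp add: K_op_def matern_def)
  moreover have "continuous_on {0..} (\<lambda>t. matern (t / b) \<nu>)" if "b > 0" for b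
    by (rule continuous_on_compose2[OF continuous_on_matern[OF \<nu>]]) (use that in \<open>auto intro!: continuous_intros\<close>)
  then have "continuous_on {0..} (K_op \<epsilon> \<nu> \<beta>2 \<beta>1 matern)"
    unfolding K_op_def[abs_def] divide_inverse[of "_ - _"] using \<beta>
    by (intro continuous_on_mult continuous_on_diff continuous_on_const) auto
  ultimately show ?thesis
    using pd by (simp add: Phi_def positive_definite_iff_pd_kernel)
qed

text \<open>
  With \<open>\<delta> = \<epsilon> - 2\<nu> \<ge> 0\<close>, the numerator is \<open>\<beta>1 powr \<delta>\<close> times the numerator for \<open>\<epsilon> = 2\<nu>\<close> plus
  \<open>\<beta>2 powr \<delta> - \<beta>1 powr \<delta> \<ge> 0\<close> times \<open>\<beta>2 powr (2\<nu>) M\<^sub>\<beta>\<^sub>2\<close>.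
\<close>

lemma K_op_matern_in_Phi_of_large_eps:
  assumes \<nu>: "\<nu> > 0" and \<beta>: "0 < \<beta>1" "\<beta>1 < \<beta>2" and \<epsilon>: "\<epsilon> \<ge> 2 * \<nu>"
  shows "K_op \<epsilon> \<nu> \<beta>2 \<beta>1 matern \<in> Phi d"
proof (rule K_op_matern_in_Phi[OF \<nu> \<beta>])
  let ?m = "\<lambda>\<beta> x y. matern (L2_set (x - y) {..<d} / \<beta>) \<nu>"
  have \<beta>2: "\<beta>2 > 0" using \<beta> by simp
  have le: "\<beta>1 powr (\<epsilon> - 2 * \<nu>) \<le> \<beta>2 powr (\<epsilon> - 2 * \<nu>)" and lt: "\<beta>1 powr \<epsilon> < \<beta>2 powr \<epsilon>"
    using \<beta> \<nu> \<epsilon> by (auto intro!: powr_mono2 powr_less_mono2)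
  show "\<beta>2 powr \<epsilon> \<noteq> \<beta>1 powr \<epsilon>" using lt by simp
  have "pd_kernel (Rd d) (\<lambda>x y. 1 / (\<beta>2 powr \<epsilon> - \<beta>1 powr \<epsilon>) *
      (\<beta>1 powr (\<epsilon> - 2 * \<nu>) * (\<beta>2 powr (2 * \<nu>) * ?m \<beta>2 x y - \<beta>1 powr (2 * \<nu>) * ?m \<beta>1 x y)
       + (\<beta>2 powr (\<epsilon> - 2 * \<nu>) - \<beta>1 powr (\<epsilon> - 2 * \<nu>)) * (\<beta>2 powr (2 * \<nu>) * ?m \<beta>2 x y)))"
    using \<nu> \<beta> \<beta>2 le lt
    by (intro pd_kernel_scale pd_kernel_add pd_kernel_matern_weighted_mono pd_kernel_matern) auto
  moreover have "1 / (\<beta>2 powr \<epsilon> - \<beta>1 powr \<epsilon>) *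
      (\<beta>1 powr (\<epsilon> - 2 * \<nu>) * (\<beta>2 powr (2 * \<nu>) * m2 - \<beta>1 powr (2 * \<nu>) * m1)
       + (\<beta>2 powr (\<epsilon> - 2 * \<nu>) - \<beta>1 powr (\<epsilon> - 2 * \<nu>)) * (\<beta>2 powr (2 * \<nu>) * m2))
      = (\<beta>2 powr \<epsilon> * m2 - \<beta>1 powr \<epsilon> * m1) / (\<beta>2 powr \<epsilon> - \<beta>1 powr \<epsilon>)" (is "_ * ?n = _") for m1 m2
  proof -
    have "?n = (\<beta>2 powr (\<epsilon> - 2 * \<nu>) * \<beta>2 powr (2 * \<nu>)) * m2 - (\<beta>1 powr (\<epsilon> - 2 * \<nu>) * \<beta>1 powr (2 * \<nu>)) * m1"
      by (simp add: algebra_simps)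
    then show ?thesis
      by (simp flip: powr_add)
  qed
  ultimately show "pd_kernel (Rd d) (\<lambda>x y. K_op \<epsilon> \<nu> \<beta>2 \<beta>1 matern (L2_set (x - y) {..<d}))"
    by (simp only: K_op_def)
qed

text \<open>
  The same splitting with \<open>\<delta> = \<epsilon> + d \<le> 0\<close>. Numerator and denominator of the operator are both
  negated, since \<open>\<beta>2 powr \<epsilon> < \<beta>1 powr \<epsilon>\<close> for \<open>\<epsilon> < 0\<close>.
\<close>

lemma K_op_matern_in_Phi_of_small_eps:
  assumes \<nu>: "\<nu> > 0" and \<beta>: "0 < \<beta>1" "\<beta>1 < \<beta>2" and \<epsilon>: "\<epsilon> < 0" "\<epsilon> \<le> - real d"
  shows "K_op \<epsilon> \<nu> \<beta>2 \<beta>1 matern \<in> Phi d"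
proof (rule K_op_matern_in_Phi[OF \<nu> \<beta>])
  let ?m = "\<lambda>\<beta> x y. matern (L2_set (x - y) {..<d} / \<beta>) \<nu>"
  have \<beta>2: "\<beta>2 > 0" using \<beta> by simp
  have le: "\<beta>2 powr (\<epsilon> + real d) \<le> \<beta>1 powr (\<epsilon> + real d)" and lt: "\<beta>2 powr \<epsilon> < \<beta>1 powr \<epsilon>"
    using \<beta> \<nu> \<epsilon> by (auto intro!: powr_mono2' powr_less_mono2_neg)
  show "\<beta>2 powr \<epsilon> \<noteq> \<beta>1 powr \<epsilon>" using lt by simp
  have "pd_kernel (Rd d) (\<lambda>x y. 1 / (\<beta>1 powr \<epsilon> - \<beta>2 powr \<epsilon>) *
      (\<beta>1 powr (\<epsilon> + real d) * (\<beta>1 powr (- real d) * ?m \<beta>1 x y - \<beta>2 powr (- real d) * ?m \<beta>2 x y)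
       + (\<beta>1 powr (\<epsilon> + real d) - \<beta>2 powr (\<epsilon> + real d)) * (\<beta>2 powr (- real d) * ?m \<beta>2 x y)))"
    using \<nu> \<beta> \<beta>2 le lt
    by (intro pd_kernel_scale pd_kernel_add pd_kernel_matern_normalized_antimono pd_kernel_matern) auto
  moreover have "1 / (\<beta>1 powr \<epsilon> - \<beta>2 powr \<epsilon>) *
      (\<beta>1 powr (\<epsilon> + real d) * (\<beta>1 powr (- real d) * m1 - \<beta>2 powr (- real d) * m2)
       + (\<beta>1 powr (\<epsilon> + real d) - \<beta>2 powr (\<epsilon> + real d)) * (\<beta>2 powr (- real d) * m2))
      = (\<beta>2 powr \<epsilon> * m2 - \<beta>1 powr \<epsilon> * m1) / (\<beta>2 powr \<epsilon> - \<beta>1 powr \<epsilon>)" (is "_ * ?n = _") for m1 m2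
  proof -
    have "?n = (\<beta>1 powr (\<epsilon> + real d) * \<beta>1 powr (- real d)) * m1 - (\<beta>2 powr (\<epsilon> + real d) * \<beta>2 powr (- real d)) * m2"
      by (simp add: algebra_simps)
    also have "\<dots> = \<beta>1 powr \<epsilon> * m1 - \<beta>2 powr \<epsilon> * m2"
      by (simp flip: powr_add)
    finally show ?thesis
      using lt by (simp add: divide_simps) (simp add: algebra_simps)
  qed
  ultimately show "pd_kernel (Rd d) (\<lambda>x y. K_op \<epsilon> \<nu> \<beta>2 \<beta>1 matern (L2_set (x - y) {..<d}))"
    by (simp only: K_op_def)
qed

section \<open>Averaging a positive definite kernel over independent samples\<close>

lemma (in prob_space) distr_PiM_two_components:
  fixes k h N :: nat
  assumes kh: "k < N" "h < N" "k \<noteq> h"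
  shows "distr (PiM {..<N} (\<lambda>_. M)) (M \<Otimes>\<^sub>M M) (\<lambda>w. (w k, w h)) = M \<Otimes>\<^sub>M M"
proof -
  let ?Q = "PiM {..<N} (\<lambda>_. M)"
  interpret P: product_prob_space "\<lambda>_. M" "{..<N}" ..
  have [measurable]: "(\<lambda>w. w k) \<in> measurable ?Q M" "(\<lambda>w. w h) \<in> measurable ?Q M"
    using kh by (auto intro!: measurable_component_singleton)
  show ?thesis
  proof (rule pair_measure_eqI[symmetric])
    show "sigma_finite_measure M" "sigma_finite_measure M" by unfold_locales
    fix A B assume A: "A \<in> sets M" and B: "B \<in> sets M"
    have "emeasure (distr ?Q (M \<Otimes>\<^sub>M M) (\<lambda>w. (w k, w h))) (A \<times> B)
        = emeasure ?Q {w \<in> space ?Q. \<forall>i\<in>{k, h}. w i \<in> (if i = k then A else B)}"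
      using A B kh by (subst emeasure_distr) (auto intro!: arg_cong[where f = "emeasure ?Q"])
    also have "\<dots> = (\<Prod>i\<in>{k, h}. emeasure M (if i = k then A else B))"
      using kh A B by (intro P.emeasure_PiM_Collect) auto
    also have "\<dots> = emeasure M A * emeasure M B"
      using kh by simp
    finally show "emeasure M A * emeasure M B = emeasure (distr ?Q (M \<Otimes>\<^sub>M M) (\<lambda>w. (w k, w h))) (A \<times> B)" ..
  qed simp
qed

text \<open>
  Average the quadratic form with unit coefficients over \<open>N\<close> independent samples. The \<open>N(N - 1)\<close>
  off-diagonal terms all have the same expectation \<open>I\<close>, and the diagonal contributes at most \<open>N C\<close>;
  hence \<open>I \<ge> - C / (N - 1)\<close> for every \<open>N \<ge> 2\<close>.
\<close>

lemma (in prob_space) pd_kernel_expectation_nonneg: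
  assumes pd: "pd_kernel (space M) B"
    and meas [measurable]: "case_prod B \<in> borel_measurable (M \<Otimes>\<^sub>M M)"
    and bound: "\<And>x y. x \<in> space M \<Longrightarrow> y \<in> space M \<Longrightarrow> \<bar>B x y\<bar> \<le> C"
  shows "0 \<le> (\<integral>z. case_prod B z \<partial>(M \<Otimes>\<^sub>M M))"
proof (rule ccontr)
  define I where "I = (\<integral>z. case_prod B z \<partial>(M \<Otimes>\<^sub>M M))"
  assume "\<not> 0 \<le> (\<integral>z. case_prod B z \<partial>(M \<Otimes>\<^sub>M M))"
  then have I: "I < 0" by (simp add: I_def)
  have sample: "0 \<le> real N * C + real N * (real N - 1) * I" for N
  proof -
    let ?Q = "PiM {..<N} (\<lambda>_. M)"
    interpret P: product_prob_space "\<lambda>_. M" "{..<N}" ..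
    have comp [measurable]: "(\<lambda>w. w k) \<in> measurable ?Q M" if "k < N" for k
      using that by (auto intro!: measurable_component_singleton)
    have sp: "w k \<in> space M" if "w \<in> space ?Q" "k < N" for w k
      using that by (auto simp: space_PiM)
    have int: "integrable ?Q (\<lambda>w. B (w k) (w h))" if "k < N" "h < N" for k h
    proof (rule P.integrable_const_bound[where B = C])
      show "AE w in ?Q. norm (B (w k) (w h)) \<le> C"
        using bound sp that by (intro AE_I2) auto
      have "(\<lambda>w. (w k, w h)) \<in> measurable ?Q (M \<Otimes>\<^sub>M M)"
        using that by measurable
      from measurable_compose[OF this meas] show "(\<lambda>w. B (w k) (w h)) \<in> borel_measurable ?Q"
        by simp
    qed
    have off: "(\<integral>w. B (w k) (w h) \<partial>?Q) = I" if "k < N" "h < N" "k \<noteq> h" for k h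
    proof -
      have "(\<lambda>w. (w k, w h)) \<in> measurable ?Q (M \<Otimes>\<^sub>M M)"
        using that by measurable
      then have "(\<integral>w. case_prod B (w k, w h) \<partial>?Q)
          = (\<integral>z. case_prod B z \<partial>distr ?Q (M \<Otimes>\<^sub>M M) (\<lambda>w. (w k, w h)))"
        by (rule integral_distr[symmetric]) (rule meas)
      then show ?thesis
        unfolding distr_PiM_two_components[OF that] I_def by simp
    qed
    have diag: "(\<integral>w. B (w k) (w k) \<partial>?Q) \<le> C" if "k < N" for k
    proof -
      have "(\<integral>w. B (w k) (w k) \<partial>?Q) \<le> (\<integral>w. C \<partial>?Q)"
        using bound sp that by (intro integral_mono int) (auto intro: order_trans[OF abs_ge_self])
      then show ?thesis by (simp add: P.P.prob_space)
    qed
    have "0 \<le> (\<integral>w. (\<Sum>k<N. \<Sum>h<N. 1 * B (w k) (w h) * 1) \<partial>?Q)"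
      using sp by (intro integral_nonneg_AE AE_I2 pd_kernelD[OF pd]) auto
    also have "\<dots> = (\<Sum>k<N. \<integral>w. (\<Sum>h<N. 1 * B (w k) (w h) * 1) \<partial>?Q)"
      using int by (intro Bochner_Integration.integral_sum Bochner_Integration.integrable_sum) simp
    also have "\<dots> = (\<Sum>k<N. \<Sum>h<N. \<integral>w. 1 * B (w k) (w h) * 1 \<partial>?Q)"
      using int by (intro sum.cong refl Bochner_Integration.integral_sum) simp
    also have "\<dots> \<le> (\<Sum>k<N. C + (real N - 1) * I)"
    proof (rule sum_mono)
      fix k assume "k \<in> {..<N}"
      then have k: "k < N" by simp
      have "(\<Sum>h<N. \<integral>w. 1 * B (w k) (w h) * 1 \<partial>?Q)
          = (\<integral>w. B (w k) (w k) \<partial>?Q) + (\<Sum>h\<in>{..<N} - {k}. \<integral>w. B (w k) (w h) \<partial>?Q)"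
        using k by (subst sum.remove[of _ k]) auto
      also have "(\<Sum>h\<in>{..<N} - {k}. \<integral>w. B (w k) (w h) \<partial>?Q) = (\<Sum>h\<in>{..<N} - {k}. I)"
        using k by (intro sum.cong refl off) auto
      also have "\<dots> = (real N - 1) * I"
        using k by (simp add: of_nat_diff)
      finally show "(\<Sum>h<N. \<integral>w. 1 * B (w k) (w h) * 1 \<partial>?Q) \<le> C + (real N - 1) * I"
        using diag[OF k] by simp
    qed
    finally show ?thesis
      by (simp add: algebra_simps)
  qed
  \<comment> \<open>With \<open>n + 1\<close> samples the diagonal can no longer compensate \<open>I < 0\<close>.\<close>
  obtain n :: nat where "C / - I < real n"
    using reals_Archimedean2 by blast
  then have "C + real n * I < 0"
    using I by (simp add: field_simps)
  moreover have "0 \<le> real (Suc n) * (C + real n * I)"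
    using sample[of "Suc n"] by (simp add: algebra_simps)
  ultimately show False
    by (simp add: zero_le_mult_iff)
qed

text \<open>
  The difference of the two independent variables is normal with variance \<open>2 \<sigma>\<^sup>2\<close>. Its density times
  the Gaussian \<open>exp(-v\<^sup>2 / 4u)\<close> is again a Gaussian, of rate \<open>q / 4\<close>, so the integral is a
  one-dimensional Fourier transform.
\<close>

lemma normal_difference_gaussian_cos:
  fixes u \<sigma> \<omega> :: real
  assumes u: "u > 0" and \<sigma>: "\<sigma> > 0"
  defines "n \<equiv> density lborel (normal_density 0 \<sigma>)" and "q \<equiv> 1 / u + 1 / \<sigma>\<^sup>2"
  shows "(\<integral>a. \<integral>b. exp (- (a - b)\<^sup>2 / (4 * u)) * cos (\<omega> * (a - b)) \<partial>n \<partial>n)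
           = exp (- \<omega>\<^sup>2 / q) / (\<sigma> * sqrt q)"
proof -
  have q: "q > 0" using u \<sigma> by (simp add: q_def add_pos_pos)
  interpret n: prob_space n
    unfolding n_def by (rule prob_space_normal_density[OF \<sigma>])
  interpret nn: pair_prob_space n n ..
  define F where "F v = exp (- v\<^sup>2 / (4 * u)) * cos (\<omega> * v)" for v
  have [measurable]: "F \<in> borel_measurable borel"
    unfolding F_def[abs_def] by measurable
  have [measurable_cong, simp]: "sets n = sets borel" by (simp add: n_def)
  have F_bound: "\<bar>F v\<bar> \<le> 1" for v
    using u by (auto simp: F_def abs_mult intro!: mult_le_one)
  have fst_n: "distr (n \<Otimes>\<^sub>M n) borel fst = n" and snd_n: "distr (n \<Otimes>\<^sub>M n) borel snd = n"
  proof -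
    have "emeasure (distr (n \<Otimes>\<^sub>M n) borel fst) A = emeasure n A"
      "emeasure (distr (n \<Otimes>\<^sub>M n) borel snd) A = emeasure n A" if "A \<in> sets borel" for A
    proof -
      have "fst -` A \<inter> space (n \<Otimes>\<^sub>M n) = A \<times> space n" "snd -` A \<inter> space (n \<Otimes>\<^sub>M n) = space n \<times> A"
        and "space n \<in> sets borel"
        by (auto simp: space_pair_measure n_def)
      then show "emeasure (distr (n \<Otimes>\<^sub>M n) borel fst) A = emeasure n A"
        "emeasure (distr (n \<Otimes>\<^sub>M n) borel snd) A = emeasure n A"
        using that by (simp_all add: emeasure_distr n.emeasure_pair_measure_Times n.emeasure_space_1)
    qed
    then show "distr (n \<Otimes>\<^sub>M n) borel fst = n" "distr (n \<Otimes>\<^sub>M n) borel snd = n"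
      by (auto intro!: measure_eqI)
  qed
  have "nn.indep_var borel fst borel snd"
    unfolding nn.indep_var_distribution_eq fst_n snd_n
    by (auto intro!: distr_id2[symmetric] sets_pair_measure_cong)
  moreover have "distributed (n \<Otimes>\<^sub>M n) lborel fst (normal_density 0 \<sigma>)"
    "distributed (n \<Otimes>\<^sub>M n) lborel snd (normal_density 0 \<sigma>)"
    using fst_n snd_n by (auto simp: distributed_def n_def cong: distr_cong)
  ultimately have D: "distributed (n \<Otimes>\<^sub>M n) lborel (\<lambda>z. fst z - snd z) (normal_density (0 - 0) (sqrt (\<sigma>\<^sup>2 + \<sigma>\<^sup>2)))"
    by (intro nn.diff_indep_normal \<sigma>)
  have "integrable (n \<Otimes>\<^sub>M n) (\<lambda>z. F (fst z - snd z))"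
    by (rule nn.integrable_const_bound[where B = 1]) (auto simp: F_bound)
  from nn.integral_fst'[OF this]
  have "(\<integral>a. \<integral>b. F (a - b) \<partial>n \<partial>n) = (\<integral>z. F (fst z - snd z) \<partial>(n \<Otimes>\<^sub>M n))"
    by simp
  also have "\<dots> = (\<integral>v. normal_density 0 (sqrt (\<sigma>\<^sup>2 + \<sigma>\<^sup>2)) v * F v \<partial>lborel)"
    using distributed_integral[OF D, of F] by simp
  also have "\<dots> = (\<integral>v. 1 / sqrt (4 * pi * \<sigma>\<^sup>2) * (exp (- (q / 4) * v\<^sup>2) * cos (v * \<omega>)) \<partial>lborel)"
  proof (rule Bochner_Integration.integral_cong[OF refl])
    fix v
    have e: "exp (- v\<^sup>2 / (4 * \<sigma>\<^sup>2)) * exp (- v\<^sup>2 / (4 * u)) = exp (- (q / 4) * v\<^sup>2)"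
      unfolding mult_exp_exp by (simp add: q_def field_simps)
    have n: "normal_density 0 (sqrt (\<sigma>\<^sup>2 + \<sigma>\<^sup>2)) v = 1 / sqrt (4 * pi * \<sigma>\<^sup>2) * exp (- v\<^sup>2 / (4 * \<sigma>\<^sup>2))"
      by (simp add: normal_density_def)
    show "normal_density 0 (sqrt (\<sigma>\<^sup>2 + \<sigma>\<^sup>2)) v * F v
        = 1 / sqrt (4 * pi * \<sigma>\<^sup>2) * (exp (- (q / 4) * v\<^sup>2) * cos (v * \<omega>))"
      unfolding F_def n e[symmetric] by (simp only: mult_ac)
  qed
  also have "\<dots> = 1 / sqrt (4 * pi * \<sigma>\<^sup>2) * (sqrt pi * (exp (- \<omega>\<^sup>2 / (4 * (q / 4))) / sqrt (q / 4)))"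
    using gaussian_fourier[of "q / 4" \<omega>] q by (simp add: has_bochner_integral_iff)
  also have "\<dots> = exp (- \<omega>\<^sup>2 / q) / (\<sigma> * sqrt q)"
    using \<sigma> q by (simp add: real_sqrt_mult real_sqrt_divide)
  finally show ?thesis unfolding F_def .
qed

section \<open>Averages of Gaussians over pairs of normal vectors\<close>

lemma matern_bounded:
  assumes \<nu>: "\<nu> > 0" and t: "t \<ge> 0"
  shows "\<bar>matern t \<nu>\<bar> \<le> 1"
proof -
  have G: "Gamma \<nu> > 0" by (rule Gamma_real_pos[OF \<nu>])
  have "\<bar>Gamma \<nu> * matern t \<nu>\<bar> = \<bar>\<integral>s. gamma_weight \<nu> s * exp (- t\<^sup>2 / (4 * (s * 1\<^sup>2))) \<partial>lborel\<bar>"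
    using matern_gaussian_mixture[OF \<nu> t, of 1] by simp
  also have "\<dots> \<le> (\<integral>s. \<bar>gamma_weight \<nu> s * exp (- t\<^sup>2 / (4 * (s * 1\<^sup>2)))\<bar> \<partial>lborel)"
    by (rule integral_abs_bound)
  also have "\<dots> \<le> (\<integral>s. gamma_weight \<nu> s \<partial>lborel)"
  proof (rule integral_mono)
    show "integrable lborel (\<lambda>s. \<bar>gamma_weight \<nu> s * exp (- t\<^sup>2 / (4 * (s * 1\<^sup>2)))\<bar>)"
      by (intro integrable_abs gamma_weight_gaussian_integrable) (use \<nu> in auto)
    show "integrable lborel (gamma_weight \<nu>)"
      using gamma_weight_integral[OF \<nu>] by (simp add: has_bochner_integral_iff)
    show "\<bar>gamma_weight \<nu> s * exp (- t\<^sup>2 / (4 * (s * 1\<^sup>2)))\<bar> \<le> gamma_weight \<nu> s" for s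
      by (auto simp: gamma_weight_def indicator_def abs_mult divide_nonpos_pos intro!: mult_left_le)
  qed
  also have "\<dots> = Gamma \<nu>"
    using gamma_weight_integral[OF \<nu>] by (simp add: has_bochner_integral_iff)
  finally show ?thesis
    using G by (simp add: abs_mult)
qed

definition normal_vector :: "nat \<Rightarrow> real \<Rightarrow> (nat \<Rightarrow> real) measure" where
  "normal_vector d \<sigma> = PiM {..<d} (\<lambda>_. density lborel (normal_density 0 \<sigma>))"

lemma prob_space_normal_vector:
  assumes "\<sigma> > 0"
  shows "prob_space (normal_vector d \<sigma>)"
  unfolding normal_vector_def by (intro prob_space_PiM prob_space_normal_density assms)

lemma measurable_normal_vector_component:
  assumes "i < d"
  shows "(\<lambda>x. x i) \<in> borel_measurable (normal_vector d \<sigma>)"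
proof -
  have "(\<lambda>x. x i) \<in> measurable (normal_vector d \<sigma>) (density lborel (normal_density 0 \<sigma>))"
    unfolding normal_vector_def using assms by (intro measurable_component_singleton) auto
  then show ?thesis by simp
qed

lemma measurable_normal_vector_dist [measurable]:
  "(\<lambda>z. L2_set (fst z - snd z) {..<d}) \<in> borel_measurable (normal_vector d \<sigma> \<Otimes>\<^sub>M normal_vector d \<sigma>)"
proof -
  have "(\<lambda>z. \<Sum>i<d. (fst z i - snd z i)\<^sup>2) \<in> borel_measurable (normal_vector d \<sigma> \<Otimes>\<^sub>M normal_vector d \<sigma>)"
  proof (rule borel_measurable_sum)
    fix i assume "i \<in> {..<d}"
    then have "i < d" by simp
    note [measurable] = measurable_normal_vector_component[OF this]
    show "(\<lambda>z. (fst z i - snd z i)\<^sup>2) \<in> borel_measurable (normal_vector d \<sigma> \<Otimes>\<^sub>M normal_vector d \<sigma>)"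
      by measurable
  qed
  then show ?thesis
    unfolding L2_set_def minus_apply by measurable
qed

lemma measurable_normal_vector_cos [measurable]:
  assumes "d \<ge> 1"
  shows "(\<lambda>z. cos (\<omega> * (fst z 0 - snd z 0))) \<in> borel_measurable (normal_vector d \<sigma> \<Otimes>\<^sub>M normal_vector d \<sigma>)"
proof -
  have "0 < d" using assms by simp
  note [measurable] = measurable_normal_vector_component[OF this]
  show ?thesis by measurable
qed

text \<open>
  Both the Gaussian and the cosine, which involves coordinate \<open>0\<close> only, factor over the coordinates.
\<close>

lemma normal_vector_gaussian_cos:
  assumes d: "d \<ge> 1" and u: "u > 0" and \<sigma>: "\<sigma> > 0"
  shows "(\<integral>z. exp (- (L2_set (fst z - snd z) {..<d})\<^sup>2 / (4 * u)) * cos (\<omega> * (fst z 0 - snd z 0))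
             \<partial>(normal_vector d \<sigma> \<Otimes>\<^sub>M normal_vector d \<sigma>))
         = exp (- \<omega>\<^sup>2 / (1 / u + 1 / \<sigma>\<^sup>2)) / (\<sigma> * sqrt (1 / u + 1 / \<sigma>\<^sup>2)) ^ d"
proof -
  define n where "n = density lborel (normal_density 0 \<sigma>)"
  define q where "q = 1 / u + 1 / \<sigma>\<^sup>2"
  \<comment> \<open>The frequency vector \<open>(\<omega>, 0, \<dots>, 0)\<close>.\<close>
  define w where "w i = (if i = 0 then \<omega> else 0)" for i :: nat
  define F where "F i v = exp (- v\<^sup>2 / (4 * u)) * cos (w i * v)" for i v
  let ?P = "normal_vector d \<sigma>"
  interpret n: prob_space n
    unfolding n_def by (rule prob_space_normal_density[OF \<sigma>])
  have [measurable_cong, simp]: "sets n = sets borel" by (simp add: n_def)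
  interpret nn: pair_prob_space n n ..
  interpret P: prob_space ?P by (rule prob_space_normal_vector[OF \<sigma>])
  interpret PP: pair_prob_space ?P ?P ..
  interpret N: product_sigma_finite "\<lambda>_::nat. n" ..
  have P_eq: "?P = PiM {..<d} (\<lambda>_. n)" by (simp add: normal_vector_def n_def)
  have [measurable]: "F i \<in> borel_measurable borel" for i
    unfolding F_def[abs_def] by measurable
  have F_bound: "\<bar>F i v\<bar> \<le> 1" for i v
    using u by (auto simp: F_def abs_mult intro!: mult_le_one)
  have F_prod: "(\<Prod>i<d. F i (x i - y i))
      = exp (- (L2_set (x - y) {..<d})\<^sup>2 / (4 * u)) * cos (\<omega> * (x 0 - y 0))" for x y :: "nat \<Rightarrow> real"
  proof -
    have "(\<Prod>i<d. F i (x i - y i)) = exp (\<Sum>i<d. - (x i - y i)\<^sup>2 / (4 * u)) * (\<Prod>i<d. cos (w i * (x i - y i)))"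
      by (simp add: F_def prod.distrib exp_sum)
    also have "(\<Sum>i<d. - (x i - y i)\<^sup>2 / (4 * u)) = - (L2_set (x - y) {..<d})\<^sup>2 / (4 * u)"
      by (simp add: L2_set_def sum_nonneg sum_negf flip: sum_divide_distrib)
    also have "(\<Prod>i<d. cos (w i * (x i - y i))) = (\<Prod>i\<in>{0}. cos (w i * (x i - y i)))"
      using d by (intro prod.mono_neutral_right) (auto simp: w_def)
    also have "\<dots> = cos (\<omega> * (x 0 - y 0))"
      by (simp add: w_def)
    finally show ?thesis .
  qed
  have int1: "integrable n (\<lambda>b. F i (a - b))" for i a
  proof (rule n.integrable_const_bound[where B = 1])
    show "(\<lambda>b. F i (a - b)) \<in> borel_measurable n" by measurable
  qed (simp add: F_bound)
  have int2: "integrable n (\<lambda>a. \<integral>b. F i (a - b) \<partial>n)" for i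
  proof -
    have "integrable (n \<Otimes>\<^sub>M n) (\<lambda>z. F i (fst z - snd z))"
      by (rule nn.integrable_const_bound[where B = 1]) (auto simp: F_bound)
    from nn.integrable_fst'[OF this] show ?thesis by simp
  qed
  have "integrable (?P \<Otimes>\<^sub>M ?P) (\<lambda>z. exp (- (L2_set (fst z - snd z) {..<d})\<^sup>2 / (4 * u)) * cos (\<omega> * (fst z 0 - snd z 0)))"
    using d u by (intro PP.integrable_const_bound[where B = 1]) (auto simp: abs_mult intro!: mult_le_one)
  from PP.integral_fst'[OF this]
  have "(\<integral>z. exp (- (L2_set (fst z - snd z) {..<d})\<^sup>2 / (4 * u)) * cos (\<omega> * (fst z 0 - snd z 0)) \<partial>(?P \<Otimes>\<^sub>M ?P))
      = (\<integral>x. \<integral>y. (\<Prod>i<d. F i (x i - y i)) \<partial>?P \<partial>?P)"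
    by (simp add: F_prod)
  also have "\<dots> = (\<integral>x. (\<Prod>i<d. \<integral>b. F i (x i - b) \<partial>n) \<partial>?P)"
    unfolding P_eq by (subst N.product_integral_prod) (auto intro: int1)
  also have "\<dots> = (\<Prod>i<d. \<integral>a. \<integral>b. F i (a - b) \<partial>n \<partial>n)"
    unfolding P_eq by (subst N.product_integral_prod) (auto intro: int2)
  also have "\<dots> = (\<Prod>i<d. exp (- (w i)\<^sup>2 / q) / (\<sigma> * sqrt q))"
    unfolding F_def n_def q_def by (intro prod.cong refl normal_difference_gaussian_cos u \<sigma>)
  also have "\<dots> = (\<Prod>i<d. exp (- (w i)\<^sup>2 / q)) / (\<sigma> * sqrt q) ^ d"
    by (simp add: prod_dividef)
  also have "(\<Prod>i<d. exp (- (w i)\<^sup>2 / q)) = (\<Prod>i\<in>{0}. exp (- (w i)\<^sup>2 / q))"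
    using d by (intro prod.mono_neutral_right) (auto simp: w_def)
  also have "\<dots> = exp (- \<omega>\<^sup>2 / q)"
    by (simp add: w_def)
  finally show ?thesis unfolding q_def .
qed

section \<open>Necessity\<close>

text \<open>
  By Fubini, the Gaussian averages are integrated against the mixing density. The factor \<open>\<sigma> ^ d\<close>
  compensates the decay of the normal density, so that the right-hand side has a limit
  for \<open>\<sigma> \<rightarrow> \<infinity>\<close>.
\<close>

lemma normal_vector_matern_cos:
  fixes \<omega> :: real
  assumes \<nu>: "\<nu> > 0" and \<beta>: "\<beta> > 0" and d: "d \<ge> 1" and \<sigma>: "\<sigma> > 0"
  defines "PP \<equiv> normal_vector d \<sigma> \<Otimes>\<^sub>M normal_vector d \<sigma>"
  shows "integrable PP (\<lambda>z. matern (L2_set (fst z - snd z) {..<d} / \<beta>) \<nu> * cos (\<omega> * (fst z 0 - snd z 0)))"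
    and "Gamma \<nu> * \<sigma> ^ d * (\<integral>z. matern (L2_set (fst z - snd z) {..<d} / \<beta>) \<nu> * cos (\<omega> * (fst z 0 - snd z 0)) \<partial>PP)
         = (\<integral>s. gamma_weight \<nu> s * (exp (- \<omega>\<^sup>2 / (1 / (s * \<beta>\<^sup>2) + 1 / \<sigma>\<^sup>2)) / sqrt (1 / (s * \<beta>\<^sup>2) + 1 / \<sigma>\<^sup>2) ^ d) \<partial>lborel)"
proof -
  let ?P = "normal_vector d \<sigma>"
  define r where "r z = L2_set (fst z - snd z) {..<d}" for z :: "(nat \<Rightarrow> real) \<times> (nat \<Rightarrow> real)"
  define c where "c z = cos (\<omega> * (fst z 0 - snd z 0))" for z :: "(nat \<Rightarrow> real) \<times> (nat \<Rightarrow> real)"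
  define f where "f z s = gamma_weight \<nu> s * exp (- (r z)\<^sup>2 / (4 * (s * \<beta>\<^sup>2))) * c z" for z s
  interpret P: prob_space ?P by (rule prob_space_normal_vector[OF \<sigma>])
  interpret PP: pair_prob_space ?P ?P ..
  interpret PP: prob_space PP unfolding PP_def by unfold_locales
  interpret S: pair_sigma_finite PP "lborel :: real measure" ..
  have [measurable]: "r \<in> borel_measurable PP"
    unfolding r_def[abs_def] PP_def by measurable
  have [measurable]: "c \<in> borel_measurable PP"
    unfolding c_def[abs_def] PP_def using d by measurable
  have r0: "r z \<ge> 0" for z by (simp add: r_def)
  have c1: "\<bar>c z\<bar> \<le> 1" for z by (simp add: c_def)
  have G: "Gamma \<nu> > 0" by (rule Gamma_real_pos[OF \<nu>])
  have gw: "integrable lborel (gamma_weight \<nu>)" "(\<integral>s. gamma_weight \<nu> s \<partial>lborel) = Gamma \<nu>"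
    using gamma_weight_integral[OF \<nu>] by (auto simp: has_bochner_integral_iff)
  have f_bound: "norm (f z s) \<le> gamma_weight \<nu> s" for z s
  proof (cases "s > 0")
    case True
    have "exp (- (r z)\<^sup>2 / (4 * (s * \<beta>\<^sup>2))) \<le> 1"
      using True \<beta> by (simp add: divide_nonpos_pos)
    then have "exp (- (r z)\<^sup>2 / (4 * (s * \<beta>\<^sup>2))) * \<bar>c z\<bar> \<le> 1"
      using c1[of z] by (intro mult_le_one) auto
    from mult_left_mono[OF this gamma_weight_nonneg[of \<nu> s]] show ?thesis
      by (simp add: f_def abs_mult gamma_weight_nonneg mult.assoc)
  qed (simp add: f_def gamma_weight_def)
  have f_meas [measurable]: "(\<lambda>z. f (fst z) (snd z)) \<in> borel_measurable (PP \<Otimes>\<^sub>M lborel)"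
    unfolding f_def[abs_def] by measurable
  have f_meas2 [measurable]: "f z \<in> borel_measurable borel" for z
    unfolding f_def[abs_def] by measurable
  have f_int_s: "integrable lborel (f z)" for z
  proof (rule Bochner_Integration.integrable_bound[OF gw(1)])
    show "AE s in lborel. norm (f z s) \<le> norm (gamma_weight \<nu> s)"
      using f_bound[of z] by (intro AE_I2) (simp add: gamma_weight_nonneg)
  qed simp
  have f_int: "integrable (PP \<Otimes>\<^sub>M lborel) (case_prod f)"
  proof (rule S.Fubini_integrable)
    show "case_prod f \<in> borel_measurable (PP \<Otimes>\<^sub>M lborel)"
      unfolding case_prod_beta' by measurable
    show "integrable PP (\<lambda>z. \<integral>s. norm (case (z, s) of (z, s) \<Rightarrow> f z s) \<partial>lborel)"
    proof (rule PP.integrable_const_bound[where B = "Gamma \<nu>"])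
      have "(\<integral>s. norm (f z s) \<partial>lborel) \<le> Gamma \<nu>" for z
        unfolding gw(2)[symmetric] by (intro integral_mono f_bound integrable_norm f_int_s gw(1))
      then show "AE z in PP. norm (\<integral>s. norm (case (z, s) of (z, s) \<Rightarrow> f z s) \<partial>lborel) \<le> Gamma \<nu>"
        by (intro AE_I2) simp
    qed (auto simp: f_def)
    show "AE z in PP. integrable lborel (\<lambda>s. case (z, s) of (z, s) \<Rightarrow> f z s)"
      using f_int_s by simp
  qed
  have inner_s: "(\<integral>s. f z s \<partial>lborel) = Gamma \<nu> * (matern (r z / \<beta>) \<nu> * c z)" for z
    using matern_gaussian_mixture[OF \<nu> r0 \<beta>, of z] by (simp add: f_def)
  have "integrable PP (\<lambda>z. \<integral>s. f z s \<partial>lborel)"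
    using S.integrable_fst'[OF f_int] by simp
  then show "integrable PP (\<lambda>z. matern (L2_set (fst z - snd z) {..<d} / \<beta>) \<nu> * cos (\<omega> * (fst z 0 - snd z 0)))"
    unfolding inner_s using G by (simp add: r_def c_def)
  have "Gamma \<nu> * (\<integral>z. matern (r z / \<beta>) \<nu> * c z \<partial>PP) = (\<integral>z. \<integral>s. f z s \<partial>lborel \<partial>PP)"
    unfolding inner_s by simp
  also have "\<dots> = (\<integral>s. \<integral>z. f z s \<partial>PP \<partial>lborel)"
    by (rule S.Fubini_integral[OF f_int, symmetric])
  finally have "Gamma \<nu> * \<sigma> ^ d * (\<integral>z. matern (r z / \<beta>) \<nu> * c z \<partial>PP) = (\<integral>s. \<sigma> ^ d * (\<integral>z. f z s \<partial>PP) \<partial>lborel)"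
    by (simp add: mult_ac)
  also have "\<dots> = (\<integral>s. gamma_weight \<nu> s * (exp (- \<omega>\<^sup>2 / (1 / (s * \<beta>\<^sup>2) + 1 / \<sigma>\<^sup>2)) / sqrt (1 / (s * \<beta>\<^sup>2) + 1 / \<sigma>\<^sup>2) ^ d) \<partial>lborel)"
  proof (rule Bochner_Integration.integral_cong[OF refl])
    fix s :: real
    show "\<sigma> ^ d * (\<integral>z. f z s \<partial>PP) = gamma_weight \<nu> s * (exp (- \<omega>\<^sup>2 / (1 / (s * \<beta>\<^sup>2) + 1 / \<sigma>\<^sup>2)) / sqrt (1 / (s * \<beta>\<^sup>2) + 1 / \<sigma>\<^sup>2) ^ d)"
    proof (cases "s > 0")
      case True
      then have "s * \<beta>\<^sup>2 > 0" using \<beta> by simp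
      from normal_vector_gaussian_cos[OF d this \<sigma>, of \<omega>]
      have "(\<integral>z. exp (- (r z)\<^sup>2 / (4 * (s * \<beta>\<^sup>2))) * c z \<partial>PP)
          = exp (- \<omega>\<^sup>2 / (1 / (s * \<beta>\<^sup>2) + 1 / \<sigma>\<^sup>2)) / (\<sigma> * sqrt (1 / (s * \<beta>\<^sup>2) + 1 / \<sigma>\<^sup>2)) ^ d"
        by (simp only: r_def c_def PP_def)
      then show ?thesis
        unfolding f_def mult.assoc integral_mult_right_zero using \<sigma>
        by (simp add: power_mult_distrib)
    qed (simp add: f_def gamma_weight_def)
  qed
  finally show "Gamma \<nu> * \<sigma> ^ d * (\<integral>z. matern (L2_set (fst z - snd z) {..<d} / \<beta>) \<nu> * cos (\<omega> * (fst z 0 - snd z 0)) \<partial>PP)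
         = (\<integral>s. gamma_weight \<nu> s * (exp (- \<omega>\<^sup>2 / (1 / (s * \<beta>\<^sup>2) + 1 / \<sigma>\<^sup>2)) / sqrt (1 / (s * \<beta>\<^sup>2) + 1 / \<sigma>\<^sup>2) ^ d) \<partial>lborel)"
    unfolding r_def c_def .
qed

text \<open>
  A Gamma integral of shape \<open>\<nu> + d/2\<close> and rate \<open>1 + \<omega>\<^sup>2 \<beta>\<^sup>2\<close>; it produces the spectral density of the
  Matern function.
\<close>

lemma gamma_weight_spectral_integral:
  assumes \<nu>: "\<nu> > 0" and \<beta>: "\<beta> > 0"
  shows "has_bochner_integral lborel (\<lambda>s. gamma_weight \<nu> s * (exp (- \<omega>\<^sup>2 * (s * \<beta>\<^sup>2)) * sqrt (s * \<beta>\<^sup>2) ^ d))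
           (Gamma (\<nu> + real d / 2) * (\<beta> ^ d * (1 + \<omega>\<^sup>2 * \<beta>\<^sup>2) powr (- (\<nu> + real d / 2))))"
proof -
  let ?a = "\<nu> + real d / 2" and ?c = "1 + \<omega>\<^sup>2 * \<beta>\<^sup>2"
  have c: "?c > 0" using \<beta> by (simp add: add_pos_nonneg)
  have "has_bochner_integral lborel (\<lambda>s. \<beta> ^ d * (indicator {0<..} s * s powr (?a - 1) * exp (- ?c * s)))
      (\<beta> ^ d * (Gamma ?a * ?c powr (- ?a)))"
    by (intro has_bochner_integral_mult_right gamma_weight_scaled_integral) (use \<nu> c in auto)
  moreover have "\<beta> ^ d * (indicator {0<..} s * s powr (?a - 1) * exp (- ?c * s))
      = gamma_weight \<nu> s * (exp (- \<omega>\<^sup>2 * (s * \<beta>\<^sup>2)) * sqrt (s * \<beta>\<^sup>2) ^ d)" for s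
  proof (cases "s > 0")
    case True
    have "s powr (?a - 1) = s powr (\<nu> - 1) * (s powr (1 / 2)) powr real d"
      unfolding powr_powr by (simp flip: powr_add add: algebra_simps)
    also have "(s powr (1 / 2)) powr real d = sqrt s ^ d"
      using True by (simp only: powr_half_sqrt less_imp_le powr_realpow real_sqrt_gt_zero)
    finally have "s powr (?a - 1) = s powr (\<nu> - 1) * sqrt s ^ d" .
    moreover have "exp (- ?c * s) = exp (- s) * exp (- \<omega>\<^sup>2 * (s * \<beta>\<^sup>2))"
      unfolding mult_exp_exp by (simp add: algebra_simps)
    moreover have "sqrt (s * \<beta>\<^sup>2) ^ d = sqrt s ^ d * \<beta> ^ d"
      using \<beta> by (simp add: real_sqrt_mult power_mult_distrib)
    ultimately show ?thesis
      using True by (simp add: gamma_weight_def)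
  qed (simp add: gamma_weight_def)
  ultimately show ?thesis
    by (simp only: mult_ac)
qed

text \<open>
  Dominated convergence along \<open>\<sigma> = n + 1\<close>: the quantity \<open>q = 1 / (s \<beta>\<^sup>2) + 1 / \<sigma>\<^sup>2\<close> decreases to
  \<open>1 / (s \<beta>\<^sup>2)\<close>, so the integrand is dominated by its limit at \<open>\<omega> = 0\<close>.
\<close>

lemma spectral_limit:
  assumes \<nu>: "\<nu> > 0" and \<beta>: "\<beta> > 0"
  shows "(\<lambda>n. \<integral>s. gamma_weight \<nu> s *
             (exp (- \<omega>\<^sup>2 / (1 / (s * \<beta>\<^sup>2) + 1 / (real (Suc n))\<^sup>2)) / sqrt (1 / (s * \<beta>\<^sup>2) + 1 / (real (Suc n))\<^sup>2) ^ d) \<partial>lborel)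
           \<longlonglongrightarrow> Gamma (\<nu> + real d / 2) * (\<beta> ^ d * (1 + \<omega>\<^sup>2 * \<beta>\<^sup>2) powr (- (\<nu> + real d / 2)))"
proof -
  define q where "q n s = 1 / (s * \<beta>\<^sup>2) + 1 / (real (Suc n))\<^sup>2" for n s
  have q_lim: "(\<lambda>n. q n s) \<longlonglongrightarrow> 1 / (s * \<beta>\<^sup>2)" for s
  proof -
    have "(\<lambda>n. 1 / (s * \<beta>\<^sup>2) + (1 / real (Suc n))\<^sup>2) \<longlonglongrightarrow> 1 / (s * \<beta>\<^sup>2) + 0\<^sup>2"
      using LIMSEQ_inverse_real_of_nat by (intro tendsto_intros) (simp add: inverse_eq_divide)
    then show ?thesis by (simp add: q_def power_divide)
  qed
  have "(\<lambda>n. \<integral>s. gamma_weight \<nu> s * (exp (- \<omega>\<^sup>2 / q n s) / sqrt (q n s) ^ d) \<partial>lborel)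
      \<longlonglongrightarrow> (\<integral>s. gamma_weight \<nu> s * (exp (- \<omega>\<^sup>2 * (s * \<beta>\<^sup>2)) * sqrt (s * \<beta>\<^sup>2) ^ d) \<partial>lborel)"
  proof (rule integral_dominated_convergence[where w = "\<lambda>s. gamma_weight \<nu> s * sqrt (s * \<beta>\<^sup>2) ^ d"])
    show "integrable lborel (\<lambda>s. gamma_weight \<nu> s * sqrt (s * \<beta>\<^sup>2) ^ d)"
      using gamma_weight_spectral_integral[OF \<nu> \<beta>, of 0 d] by (simp add: has_bochner_integral_iff)
    show "AE s in lborel. (\<lambda>n. gamma_weight \<nu> s * (exp (- \<omega>\<^sup>2 / q n s) / sqrt (q n s) ^ d))
        \<longlonglongrightarrow> gamma_weight \<nu> s * (exp (- \<omega>\<^sup>2 * (s * \<beta>\<^sup>2)) * sqrt (s * \<beta>\<^sup>2) ^ d)"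
    proof (rule AE_I2)
      fix s
      show "(\<lambda>n. gamma_weight \<nu> s * (exp (- \<omega>\<^sup>2 / q n s) / sqrt (q n s) ^ d))
          \<longlonglongrightarrow> gamma_weight \<nu> s * (exp (- \<omega>\<^sup>2 * (s * \<beta>\<^sup>2)) * sqrt (s * \<beta>\<^sup>2) ^ d)"
      proof (cases "s > 0")
        case True
        then have p: "s * \<beta>\<^sup>2 > 0" using \<beta> by simp
        have "(\<lambda>n. gamma_weight \<nu> s * (exp (- \<omega>\<^sup>2 / q n s) / sqrt (q n s) ^ d))
            \<longlonglongrightarrow> gamma_weight \<nu> s * (exp (- \<omega>\<^sup>2 / (1 / (s * \<beta>\<^sup>2))) / sqrt (1 / (s * \<beta>\<^sup>2)) ^ d)"
          using p by (intro tendsto_intros q_lim) auto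
        moreover have "exp (- \<omega>\<^sup>2 / (1 / (s * \<beta>\<^sup>2))) / sqrt (1 / (s * \<beta>\<^sup>2)) ^ d
            = exp (- \<omega>\<^sup>2 * (s * \<beta>\<^sup>2)) * sqrt (s * \<beta>\<^sup>2) ^ d"
          by (simp add: real_sqrt_divide power_divide)
        ultimately show ?thesis by (simp only:)
      qed (simp add: gamma_weight_def)
    qed
    show "AE s in lborel. norm (gamma_weight \<nu> s * (exp (- \<omega>\<^sup>2 / q n s) / sqrt (q n s) ^ d))
        \<le> gamma_weight \<nu> s * sqrt (s * \<beta>\<^sup>2) ^ d" for n
    proof (rule AE_I2)
      fix s
      show "norm (gamma_weight \<nu> s * (exp (- \<omega>\<^sup>2 / q n s) / sqrt (q n s) ^ d)) \<le> gamma_weight \<nu> s * sqrt (s * \<beta>\<^sup>2) ^ d"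
      proof (cases "s > 0")
        case True
        then have p: "s * \<beta>\<^sup>2 > 0" using \<beta> by simp
        have q: "q n s > 0" using p by (simp add: q_def add_pos_nonneg)
        have "1 / (s * \<beta>\<^sup>2) \<le> q n s"
          by (simp add: q_def)
        from le_imp_inverse_le[OF this] have "1 / q n s \<le> s * \<beta>\<^sup>2"
          using p by (simp add: inverse_eq_divide)
        then have "sqrt (1 / q n s) ^ d \<le> sqrt (s * \<beta>\<^sup>2) ^ d"
          using q by (intro power_mono real_sqrt_le_mono) auto
        moreover have "exp (- \<omega>\<^sup>2 / q n s) \<le> 1"
          using q by (simp add: divide_nonpos_pos)
        ultimately have "exp (- \<omega>\<^sup>2 / q n s) * sqrt (1 / q n s) ^ d \<le> 1 * sqrt (s * \<beta>\<^sup>2) ^ d"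
          using q by (intro mult_mono) auto
        then have "\<bar>exp (- \<omega>\<^sup>2 / q n s) / sqrt (q n s) ^ d\<bar> \<le> sqrt (s * \<beta>\<^sup>2) ^ d"
          using q by (simp add: real_sqrt_divide power_divide)
        from mult_left_mono[OF this gamma_weight_nonneg[of \<nu> s]] show ?thesis
          by (simp add: abs_mult gamma_weight_nonneg)
      qed (simp add: gamma_weight_def)
    qed
  qed (unfold q_def, measurable)
  then show ?thesis
    using gamma_weight_spectral_integral[OF \<nu> \<beta>, of \<omega> d]
    by (simp add: q_def has_bochner_integral_iff)
qed

text \<open>
  The kernel depends on the first \<open>d\<close> coordinates only, so arbitrary sequences can be truncated to
  points of \<open>Rd d\<close>. This admits the points of a product measure, which are
  \<open>undefined\<close> outside their index set.
\<close>

lemma radial_pd_kernel: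
  assumes "positive_definite d (\<lambda>x. \<phi> (L2_set x {..<d}))"
  shows "pd_kernel S (\<lambda>x y. \<phi> (L2_set (x - y) {..<d}))"
proof (rule pd_kernelI)
  fix N :: nat and a :: "nat \<Rightarrow> real" and x :: "nat \<Rightarrow> nat \<Rightarrow> real"
  define y where "y k i = (if i < d then x k i else 0)" for k i
  have "0 \<le> (\<Sum>k<N. \<Sum>h<N. a k * \<phi> (L2_set (y k - y h) {..<d}) * a h)"
    using assms unfolding positive_definite_def by (auto simp: Rd_def y_def)
  moreover have "L2_set (y k - y h) {..<d} = L2_set (x k - x h) {..<d}" for k h
    by (intro L2_set_cong) (auto simp: y_def)
  ultimately show "0 \<le> (\<Sum>k<N. \<Sum>h<N. a k * \<phi> (L2_set (x k - x h) {..<d}) * a h)"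
    by simp
qed

text \<open>
  The averages of the kernel \<open>\<phi>(\<parallel>x - y\<parallel>) cos(\<omega>(x\<^sub>0 - y\<^sub>0))\<close> over pairs of normal vectors are nonnegative;
  the claim is their limit for \<open>\<sigma> \<rightarrow> \<infinity>\<close>, divided by the positive constant \<open>\<Gamma>(\<nu> + d/2)\<close>.
\<close>

lemma K_op_matern_spectral_density_nonneg:
  assumes \<nu>: "\<nu> > 0" and \<beta>1: "\<beta>1 > 0" and \<beta>2: "\<beta>2 > 0" and d: "d \<ge> 1"
    and Phi: "K_op \<epsilon> \<nu> \<beta>2 \<beta>1 matern \<in> Phi d"
  shows "0 \<le> (\<beta>2 powr (\<epsilon> + real d) * (1 + \<omega>\<^sup>2 * \<beta>2\<^sup>2) powr (- (\<nu> + real d / 2))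
             - \<beta>1 powr (\<epsilon> + real d) * (1 + \<omega>\<^sup>2 * \<beta>1\<^sup>2) powr (- (\<nu> + real d / 2)))
           / (\<beta>2 powr \<epsilon> - \<beta>1 powr \<epsilon>)"
proof -
  define D where "D = \<beta>2 powr \<epsilon> - \<beta>1 powr \<epsilon>"
  define L where "L \<beta> = Gamma (\<nu> + real d / 2) * (\<beta> ^ d * (1 + \<omega>\<^sup>2 * \<beta>\<^sup>2) powr (- (\<nu> + real d / 2)))" for \<beta>
  define A where "A \<beta> n = (\<integral>s. gamma_weight \<nu> s *
      (exp (- \<omega>\<^sup>2 / (1 / (s * \<beta>\<^sup>2) + 1 / (real (Suc n))\<^sup>2)) / sqrt (1 / (s * \<beta>\<^sup>2) + 1 / (real (Suc n))\<^sup>2) ^ d) \<partial>lborel)"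
    for \<beta> n
  have G: "Gamma \<nu> > 0" by (rule Gamma_real_pos[OF \<nu>])
  have nonneg: "0 \<le> (\<beta>2 powr \<epsilon> * A \<beta>2 n - \<beta>1 powr \<epsilon> * A \<beta>1 n) / D" for n
  proof -
    define \<sigma> where "\<sigma> = real (Suc n)"
    have \<sigma>: "\<sigma> > 0" by (simp add: \<sigma>_def)
    let ?P = "normal_vector d \<sigma>"
    define m where "m \<beta> z = matern (L2_set (fst z - snd z) {..<d} / \<beta>) \<nu> * cos (\<omega> * (fst z 0 - snd z 0))"
      for \<beta> and z :: "(nat \<Rightarrow> real) \<times> (nat \<Rightarrow> real)"
    define B where "B x y = K_op \<epsilon> \<nu> \<beta>2 \<beta>1 matern (L2_set (x - y) {..<d}) * cos (\<omega> * x 0 - \<omega> * y 0)"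
      for x y :: "nat \<Rightarrow> real"
    interpret P: prob_space ?P by (rule prob_space_normal_vector[OF \<sigma>])
    note int1 = normal_vector_matern_cos(1)[OF \<nu> \<beta>1 d \<sigma>, of \<omega>, folded m_def]
    note int2 = normal_vector_matern_cos(1)[OF \<nu> \<beta>2 d \<sigma>, of \<omega>, folded m_def]
    have B_eq: "case_prod B = (\<lambda>z. (\<beta>2 powr \<epsilon> * m \<beta>2 z - \<beta>1 powr \<epsilon> * m \<beta>1 z) / D)"
      by (auto simp: fun_eq_iff B_def m_def K_op_def D_def algebra_simps diff_divide_distrib)
    have "pd_kernel (space ?P) B"
      unfolding B_def[abs_def] using Phi
      by (intro pd_kernel_mult_cos radial_pd_kernel) (simp add: Phi_def)
    moreover have "case_prod B \<in> borel_measurable (?P \<Otimes>\<^sub>M ?P)"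
      unfolding B_eq using int1[THEN borel_measurable_integrable] int2[THEN borel_measurable_integrable]
      by measurable
    moreover have "\<bar>B x y\<bar> \<le> (\<beta>2 powr \<epsilon> + \<beta>1 powr \<epsilon>) / \<bar>D\<bar>" for x y
    proof -
      have m1: "\<bar>m \<beta> (x, y)\<bar> \<le> 1" if "\<beta> > 0" for \<beta>
        using matern_bounded[OF \<nu>, of "L2_set (x - y) {..<d} / \<beta>"] that
        by (auto simp: m_def abs_mult intro!: mult_le_one)
      have "\<bar>\<beta>2 powr \<epsilon> * m \<beta>2 (x, y) - \<beta>1 powr \<epsilon> * m \<beta>1 (x, y)\<bar>
          \<le> \<bar>\<beta>2 powr \<epsilon> * m \<beta>2 (x, y)\<bar> + \<bar>\<beta>1 powr \<epsilon> * m \<beta>1 (x, y)\<bar>"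
        by (rule abs_triangle_ineq4)
      also have "\<dots> \<le> \<beta>2 powr \<epsilon> + \<beta>1 powr \<epsilon>"
        using m1[OF \<beta>1] m1[OF \<beta>2] by (intro add_mono) (auto simp: abs_mult intro!: mult_left_le)
      finally show ?thesis
        using fun_cong[OF B_eq, of "(x, y)"] by (simp add: divide_right_mono)
    qed
    ultimately have "0 \<le> (\<integral>z. case_prod B z \<partial>(?P \<Otimes>\<^sub>M ?P))"
      by (rule P.pd_kernel_expectation_nonneg)
    also have "\<dots> = (\<beta>2 powr \<epsilon> * (\<integral>z. m \<beta>2 z \<partial>(?P \<Otimes>\<^sub>M ?P)) - \<beta>1 powr \<epsilon> * (\<integral>z. m \<beta>1 z \<partial>(?P \<Otimes>\<^sub>M ?P))) / D"
      unfolding B_eq using int1 int2 by simp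
    finally have "0 \<le> Gamma \<nu> * \<sigma> ^ d * ((\<beta>2 powr \<epsilon> * (\<integral>z. m \<beta>2 z \<partial>(?P \<Otimes>\<^sub>M ?P)) - \<beta>1 powr \<epsilon> * (\<integral>z. m \<beta>1 z \<partial>(?P \<Otimes>\<^sub>M ?P))) / D)"
      using G \<sigma> by (intro mult_nonneg_nonneg) auto
    also have "\<dots> = (\<beta>2 powr \<epsilon> * (Gamma \<nu> * \<sigma> ^ d * (\<integral>z. m \<beta>2 z \<partial>(?P \<Otimes>\<^sub>M ?P)))
        - \<beta>1 powr \<epsilon> * (Gamma \<nu> * \<sigma> ^ d * (\<integral>z. m \<beta>1 z \<partial>(?P \<Otimes>\<^sub>M ?P)))) / D"
      by (simp add: algebra_simps diff_divide_distrib)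
    also have "\<dots> = (\<beta>2 powr \<epsilon> * A \<beta>2 n - \<beta>1 powr \<epsilon> * A \<beta>1 n) / D"
      unfolding normal_vector_matern_cos(2)[OF \<nu> \<beta>1 d \<sigma>, of \<omega>, folded m_def]
        normal_vector_matern_cos(2)[OF \<nu> \<beta>2 d \<sigma>, of \<omega>, folded m_def]
      by (simp only: A_def \<sigma>_def)
    finally show ?thesis .
  qed
  have "(\<lambda>n. (\<beta>2 powr \<epsilon> * A \<beta>2 n - \<beta>1 powr \<epsilon> * A \<beta>1 n) * inverse D)
      \<longlonglongrightarrow> (\<beta>2 powr \<epsilon> * L \<beta>2 - \<beta>1 powr \<epsilon> * L \<beta>1) * inverse D"
    unfolding A_def L_def by (intro tendsto_intros spectral_limit \<nu> \<beta>1 \<beta>2)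
  then have "0 \<le> (\<beta>2 powr \<epsilon> * L \<beta>2 - \<beta>1 powr \<epsilon> * L \<beta>1) * inverse D"
    by (rule LIMSEQ_le_const) (use nonneg in \<open>auto simp: divide_inverse\<close>)
  also have "\<dots> = Gamma (\<nu> + real d / 2) *
      ((\<beta>2 powr (\<epsilon> + real d) * (1 + \<omega>\<^sup>2 * \<beta>2\<^sup>2) powr (- (\<nu> + real d / 2))
      - \<beta>1 powr (\<epsilon> + real d) * (1 + \<omega>\<^sup>2 * \<beta>1\<^sup>2) powr (- (\<nu> + real d / 2))) / D)"
  proof -
    have "b powr \<epsilon> * L b = Gamma (\<nu> + real d / 2) * (b powr (\<epsilon> + real d) * (1 + \<omega>\<^sup>2 * b\<^sup>2) powr (- (\<nu> + real d / 2)))"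
      if "b > 0" for b
      using that by (simp add: L_def powr_add powr_realpow mult_ac)
    from this[OF \<beta>1] this[OF \<beta>2] show ?thesis
      by (simp only: right_diff_distrib[symmetric] divide_inverse mult.assoc)
  qed
  finally have "0 \<le> Gamma (\<nu> + real d / 2) *
      ((\<beta>2 powr (\<epsilon> + real d) * (1 + \<omega>\<^sup>2 * \<beta>2\<^sup>2) powr (- (\<nu> + real d / 2))
      - \<beta>1 powr (\<epsilon> + real d) * (1 + \<omega>\<^sup>2 * \<beta>1\<^sup>2) powr (- (\<nu> + real d / 2))) / D)" .
  moreover have "Gamma (\<nu> + real d / 2) > 0"
    using \<nu> by (intro Gamma_real_pos) (simp add: add_pos_nonneg)
  moreover have "0 \<le> c * x \<Longrightarrow> c > 0 \<Longrightarrow> 0 \<le> x" for c x :: real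
    by (simp add: zero_le_mult_iff)
  ultimately show ?thesis
    unfolding D_def by blast
qed

text \<open>
  Multiplying the spectral inequality for \<open>d = 1\<close> by \<open>\<omega> powr (2\<nu> + 1)\<close> and letting \<open>\<omega> \<rightarrow> \<infinity>\<close> leaves
  \<open>\<beta>1 powr (\<epsilon> - 2\<nu>) \<le> \<beta>2 powr (\<epsilon> - 2\<nu>)\<close>.
\<close>

lemma K_op_matern_in_Phi_imp_large_eps:
  assumes \<nu>: "\<nu> > 0" and \<beta>: "0 < \<beta>1" "\<beta>1 < \<beta>2" and \<epsilon>: "\<epsilon> > 0"
    and Phi: "K_op \<epsilon> \<nu> \<beta>2 \<beta>1 matern \<in> Phi 1"
  shows "\<epsilon> \<ge> 2 * \<nu>"
proof (rule ccontr)
  assume "\<not> \<epsilon> \<ge> 2 * \<nu>"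
  then have less: "\<beta>2 powr (\<epsilon> - 2 * \<nu>) < \<beta>1 powr (\<epsilon> - 2 * \<nu>)"
    using \<beta> by (intro powr_less_mono2_neg) auto
  define a where "a = \<nu> + 1 / 2"
  define g where "g \<beta> n = \<beta> powr (\<epsilon> + 1) * (\<beta>\<^sup>2 + (1 / real (Suc n))\<^sup>2) powr (- a)" for \<beta> n
  have pos: "\<beta>2 powr \<epsilon> - \<beta>1 powr \<epsilon> > 0"
    using \<beta> \<epsilon> by (simp add: powr_less_mono2)
  have "g \<beta>1 n \<le> g \<beta>2 n" for n
  proof -
    define \<omega> where "\<omega> = real (Suc n)"
    have \<omega>: "\<omega> > 0" by (simp add: \<omega>_def)
    \<comment> \<open>Factoring out \<open>\<omega>\<^sup>2\<close> makes the limit \<open>\<omega> \<rightarrow> \<infinity>\<close> visible.\<close>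
    have scale: "(1 + \<omega>\<^sup>2 * b\<^sup>2) powr (- a) = (\<omega>\<^sup>2) powr (- a) * (b\<^sup>2 + (1 / \<omega>)\<^sup>2) powr (- a)" for b
      using \<omega> by (subst powr_mult[symmetric]) (auto simp: power_divide distrib_left add.commute)
    have "0 \<le> (\<omega>\<^sup>2) powr (- a) * (g \<beta>2 n - g \<beta>1 n) / (\<beta>2 powr \<epsilon> - \<beta>1 powr \<epsilon>)"
      using K_op_matern_spectral_density_nonneg[OF \<nu> \<beta>(1) _ _ Phi, of \<omega>] \<beta>
      unfolding a_def[symmetric] of_nat_1 scale by (simp add: g_def \<omega>_def algebra_simps)
    then show ?thesis
      using pos \<omega> by (simp add: zero_le_divide_iff zero_le_mult_iff)
  qed
  moreover have lim: "g b \<longlonglongrightarrow> b powr (\<epsilon> - 2 * \<nu>)" if b: "b > 0" for b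
  proof -
    have "(\<lambda>n. b powr (\<epsilon> + 1) * (b\<^sup>2 + (1 / real (Suc n))\<^sup>2) powr (- a))
        \<longlonglongrightarrow> b powr (\<epsilon> + 1) * (b\<^sup>2 + 0\<^sup>2) powr (- a)"
      using LIMSEQ_inverse_real_of_nat b by (intro tendsto_intros) (auto simp: inverse_eq_divide)
    moreover have "(b\<^sup>2) powr (- a) = b powr (- 2 * a)"
      using b powr_powr[of b 2 "- a"] by (simp add: powr_numeral)
    then have "b powr (\<epsilon> + 1) * (b\<^sup>2 + 0\<^sup>2) powr (- a) = b powr (\<epsilon> - 2 * \<nu>)"
      by (simp add: a_def algebra_simps flip: powr_add)
    ultimately show ?thesis
      by (simp add: g_def[abs_def])
  qed
  ultimately have "\<beta>1 powr (\<epsilon> - 2 * \<nu>) \<le> \<beta>2 powr (\<epsilon> - 2 * \<nu>)"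
    using \<beta> by (intro LIMSEQ_le[OF lim lim]) auto
  with less show False by simp
qed

text \<open>
  At frequency \<open>\<omega> = 0\<close> the spectral density is
  \<open>(\<beta>2 powr (\<epsilon> + d) - \<beta>1 powr (\<epsilon> + d)) / (\<beta>2 powr \<epsilon> - \<beta>1 powr \<epsilon>)\<close>, with negative denominator.
\<close>

lemma K_op_matern_in_Phi_imp_small_eps:
  assumes \<nu>: "\<nu> > 0" and \<beta>: "0 < \<beta>1" "\<beta>1 < \<beta>2" and \<epsilon>: "\<epsilon> < 0" and d: "d \<ge> 1"
    and Phi: "K_op \<epsilon> \<nu> \<beta>2 \<beta>1 matern \<in> Phi d"
  shows "\<epsilon> \<le> - real d"
proof (rule ccontr)
  assume "\<not> \<epsilon> \<le> - real d"
  then have "\<beta>1 powr (\<epsilon> + real d) < \<beta>2 powr (\<epsilon> + real d)"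
    using \<beta> by (intro powr_less_mono2) auto
  moreover have "\<beta>2 powr \<epsilon> - \<beta>1 powr \<epsilon> < 0"
    using \<beta> \<epsilon> by (simp add: powr_less_mono2_neg)
  ultimately have "(\<beta>2 powr (\<epsilon> + real d) - \<beta>1 powr (\<epsilon> + real d)) / (\<beta>2 powr \<epsilon> - \<beta>1 powr \<epsilon>) < 0"
    by (simp add: divide_pos_neg)
  moreover have "0 \<le> (\<beta>2 powr (\<epsilon> + real d) - \<beta>1 powr (\<epsilon> + real d)) / (\<beta>2 powr \<epsilon> - \<beta>1 powr \<epsilon>)"
    using K_op_matern_spectral_density_nonneg[OF \<nu> \<beta>(1) _ d Phi, of 0] \<beta> by simp
  ultimately show False by simp
qed

theorem theorem3p1:
  fixes \<nu> \<beta>1 \<beta>2 :: real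
  assumes "\<nu> > 0" and "0 < \<beta>1" and "\<beta>1 < \<beta>2"
  shows "(\<forall>\<epsilon>::real. \<epsilon> > 0 \<longrightarrow>
            (K_op \<epsilon> \<nu> \<beta>2 \<beta>1 matern \<in> Phi_inf \<longleftrightarrow> \<epsilon> \<ge> 2 * \<nu> \<and> 2 * \<nu> > 0)) \<and>
         (\<forall>(d::nat) (\<epsilon>::real). d \<ge> 1 \<longrightarrow> \<epsilon> < 0 \<longrightarrow>
            (K_op \<epsilon> \<nu> \<beta>2 \<beta>1 matern \<in> Phi d \<longleftrightarrow> \<epsilon> \<le> - real d \<and> - real d < 0))"
proof (intro conjI allI impI)
  fix \<epsilon> :: real
  assume "\<epsilon> > 0"
  show "K_op \<epsilon> \<nu> \<beta>2 \<beta>1 matern \<in> Phi_inf \<longleftrightarrow> \<epsilon> \<ge> 2 * \<nu> \<and> 2 * \<nu> > 0"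
  proof
    assume "K_op \<epsilon> \<nu> \<beta>2 \<beta>1 matern \<in> Phi_inf"
    then have "K_op \<epsilon> \<nu> \<beta>2 \<beta>1 matern \<in> Phi 1"
      by (auto simp: Phi_inf_def)
    then show "\<epsilon> \<ge> 2 * \<nu> \<and> 2 * \<nu> > 0"
      using K_op_matern_in_Phi_imp_large_eps[OF assms \<open>\<epsilon> > 0\<close>] assms(1) by simp
  next
    assume "\<epsilon> \<ge> 2 * \<nu> \<and> 2 * \<nu> > 0"
    then show "K_op \<epsilon> \<nu> \<beta>2 \<beta>1 matern \<in> Phi_inf"
      using K_op_matern_in_Phi_of_large_eps[OF assms] by (simp add: Phi_inf_def)
  qed
next
  fix d :: nat and \<epsilon> :: real
  assume "d \<ge> 1" "\<epsilon> < 0"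
  then show "K_op \<epsilon> \<nu> \<beta>2 \<beta>1 matern \<in> Phi d \<longleftrightarrow> \<epsilon> \<le> - real d \<and> - real d < 0"
    using K_op_matern_in_Phi_of_small_eps[OF assms] K_op_matern_in_Phi_imp_small_eps[OF assms] by auto
qed

end
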